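(* Assume (E) (stated in the context), and let $c,t_0,r>0$ be such that for all $x_0$, all $0<t\le t_0$ and $|y^0|\le \frac ct$ the map $(q_0,p^0)\mapsto (X,Y)(t,x_0,y^0,q_0,p^0)$ is a diffeomorphism from $B_{c^2/t^2}\times B_{c^3/t^3}$ onto its image and this image contains $D=D(x_0,y^0)=B_r(\tilde x(t))\times B_{r/t}(\tilde y(t))$, where $(\tilde x(t),\tilde y(t))=(X,Y)(t,x_0,y^0,0,0)$. Then the two-point function $S(t,x,y,x_0,y^0)$ satisfies the Hamilton–Jacobi equation $$\frac{\partial S}{\partial t}+H\Big(x,y,\frac{\partial S}{\partial x},\frac{\partial S}{\partial y}\Big)=0$$ as a function of $t\in(0,t_0]$ and $(x,y)\in D(x_0,y^0)$, where $\frac{\partial S}{\partial x}$ is substituted for $p$ and $\frac{\partial S}{\partial y}$ for $q$. Moreover, $$\frac{\partial S}{\partial x}=p(t,x,y),\quad \frac{\partial S}{\partial y}=q(t,x,y),\quad \frac{\partial S}{\partial x_0}=-p^0(t,x,y),\quad \frac{\partial S}{\partial y^0}=-q_0(t,x,y),$$ where $(q_0,p^0)(t,x,y)$ and $(q,p)(t,x,y)$ are the initial and the final (time $t$) momenta of the characteristic joining $(x_0,y^0)$ to $(x,y)$ in time $t$.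
   Context: $M$ is a compact $d$-dimensional Riemannian manifold; we work in local coordinates $(x,y)\in\mathbb{R}^d\times\mathbb{R}^d$ on $T^*M$. $g(x)=(g_{ij}(x))$ is the smooth positive definite matrix of the metric in these coordinates and $G(x)=g(x)^{-1}$; $g$, $G$ and their derivatives are bounded. $(\cdot,\cdot)$ is the Euclidean inner product, and $(\frac{\partial}{\partial x}(G(x)y,y),q)=\sum_i q^i\,\frac{\partial}{\partial x^i}(G(x)y,y)$. $B_\rho(a)$ is the ball of radius $\rho$ about $a$ in $\mathbb{R}^d$, $B_\rho=B_\rho(0)$. The Hamiltonian is $$H=\tfrac12 (g(x)q,q)-(G(x)y,p)+\tfrac12\Big(\tfrac{\partial}{\partial x}(G(x)y,y),q\Big),$$ where $p$ is conjugate to $x$ and $q$ is conjugate to $y$. The Hamiltonian system is $$\dot x=\frac{\partial H}{\partial p},\quad \dot y=\frac{\partial H}{\partial q},\quad \dot q=-\frac{\partial H}{\partial y},\quad \dot p=-\frac{\partial H}{\partial x},$$ with initial condition $(x_0,y^0,q_0,p^0)$; its flow is denoted $(X,Y,Q,P)(t,x_0,y^0,q_0,p^0)$. The projections of solutions to the $(x,y)$-space are called characteristics. Assumption (E): there are constants $t_0,c_0>0$ such that for all $c\in(0,c_0]$ and $t\in(0,t_0]$ the solution of the Hamiltonian system exists on $[0,t]$ whenever $|y^0|\le \frac{c}{t}$, $|q_0|\le\frac{c^2}{t^2}$, $|p^0|\le\frac{c^3}{t^3}$, with $x_0$ arbitrary. For $(x,y)\in D(x_0,y^0)$ let $(Q_0,P^0)(t,x,y,x_0,y^0)$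 be the unique $(q_0,p^0)$ in the polydisc with $(X,Y)(t,x_0,y^0,q_0,p^0)=(x,y)$. Put $$\sigma(t,x_0,y^0,q_0,p^0)=\int_0^t\big[(P,\dot X)+(Q,\dot Y)-H\big](\tau)\,d\tau,$$ the integrand being evaluated along the solution with initial data $(x_0,y^0,q_0,p^0)$. The two-point function is $S(t,x,y,x_0,y^0)=\sigma(t,x_0,y^0,Q_0(t,x,y,x_0,y^0),P^0(t,x,y,x_0,y^0))$. *)

theory Defs
  imports "HOL-Analysis.Analysis"
begin

(* Iterated directional derivatives; over lists of basis vectors these are the iterated
   partial derivatives of f. *)
primrec iterated_deriv ::
  "'a::euclidean_space list \<Rightarrow> ('a \<Rightarrow> 'b::real_normed_vector) \<Rightarrow> 'a \<Rightarrow> 'b" where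
  "iterated_deriv [] f = f"
| "iterated_deriv (v # vs) f = (\<lambda>x. frechet_derivative (iterated_deriv vs f) (at x) v)"

(* C-infinity: partial derivatives of every order exist and are (totally) differentiable,
   hence also continuous. *)
definition smooth_on :: "'a::euclidean_space set \<Rightarrow> ('a \<Rightarrow> 'b::real_normed_vector) \<Rightarrow> bool" where
  "smooth_on U f \<longleftrightarrow>
     open U \<and> (\<forall>vs. set vs \<subseteq> Basis \<longrightarrow> iterated_deriv vs f differentiable_on U)"

definition bounded_with_derivs :: "('a::euclidean_space \<Rightarrow> 'b::real_normed_vector) \<Rightarrow> bool" where
  "bounded_with_derivs f \<longleftrightarrow> (\<forall>vs. set vs \<subseteq> Basis \<longrightarrow> bounded (range (iterated_deriv vs f)))"

definition diffeo_onto_image :: "'a::euclidean_space set \<Rightarrow> ('a \<Rightarrow> 'b::euclidean_space) \<Rightarrow> bool" where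
  "diffeo_onto_image U f \<longleftrightarrow>
     inj_on f U \<and> smooth_on U f \<and> smooth_on (f ` U) (inv_into U f)"

definition gradient :: "(real^'d \<Rightarrow> real) \<Rightarrow> real^'d \<Rightarrow> real^'d" where
  "gradient f x = (\<chi> i. frechet_derivative f (at x) (axis i 1))"

definition metric_coefficients :: "(real^'d \<Rightarrow> real^'d^'d) \<Rightarrow> bool" where
  "metric_coefficients g \<longleftrightarrow>
     smooth_on UNIV g \<and>
     (\<forall>x. transpose (g x) = g x \<and> (\<forall>v. v \<noteq> 0 \<longrightarrow> (g x *v v) \<bullet> v > 0)) \<and>
     bounded_with_derivs g \<and> bounded_with_derivs (\<lambda>x. matrix_inv (g x))"

definition hamiltonian ::
  "(real^'d \<Rightarrow> real^'d^'d) \<Rightarrow> real^'d \<Rightarrow> real^'d \<Rightarrow> real^'d \<Rightarrow> real^'d \<Rightarrow> real" where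
  "hamiltonian g x y q p =
     1/2 * ((g x *v q) \<bullet> q) - (matrix_inv (g x) *v y) \<bullet> p
     + 1/2 * (gradient (\<lambda>x'. (matrix_inv (g x') *v y) \<bullet> y) x \<bullet> q)"

(* Phase space points, in the order (x, y, q, p): p is conjugate to x, and q to y. *)
type_synonym 'd phase = "(real^'d) \<times> (real^'d) \<times> (real^'d) \<times> (real^'d)"

definition hamiltonian_field :: "(real^'d \<Rightarrow> real^'d^'d) \<Rightarrow> 'd phase \<Rightarrow> 'd phase" where
  "hamiltonian_field g = (\<lambda>(x, y, q, p).
     (gradient (\<lambda>p'. hamiltonian g x y q p') p,
      gradient (\<lambda>q'. hamiltonian g x y q' p) q,
      - gradient (\<lambda>y'. hamiltonian g x y' q p) y,
      - gradient (\<lambda>x'. hamiltonian g x' y q p) x))"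

definition is_solution ::
  "(real^'d \<Rightarrow> real^'d^'d) \<Rightarrow> real \<Rightarrow> 'd phase \<Rightarrow> (real \<Rightarrow> 'd phase) \<Rightarrow> bool" where
  "is_solution g t z0 z \<longleftrightarrow> z 0 = z0 \<and>
     (\<forall>s\<in>{0..t}. (z has_vector_derivative hamiltonian_field g (z s)) (at s within {0..t}))"

definition solution_exists :: "(real^'d \<Rightarrow> real^'d^'d) \<Rightarrow> real \<Rightarrow> 'd phase \<Rightarrow> bool" where
  "solution_exists g t z0 \<longleftrightarrow> (\<exists>z. is_solution g t z0 z)"

(* Meaningful only if solution_exists g t z0 holds; solutions are then unique on {0..t}. *)
definition flow :: "(real^'d \<Rightarrow> real^'d^'d) \<Rightarrow> real \<Rightarrow> 'd phase \<Rightarrow> 'd phase" where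
  "flow g t z0 = (THE w. \<exists>z. is_solution g t z0 z \<and> z t = w)"

definition flow_X :: "(real^'d \<Rightarrow> real^'d^'d) \<Rightarrow> real \<Rightarrow> 'd phase \<Rightarrow> real^'d" where
  "flow_X g t z0 = fst (flow g t z0)"

definition flow_Y :: "(real^'d \<Rightarrow> real^'d^'d) \<Rightarrow> real \<Rightarrow> 'd phase \<Rightarrow> real^'d" where
  "flow_Y g t z0 = fst (snd (flow g t z0))"

definition flow_Q :: "(real^'d \<Rightarrow> real^'d^'d) \<Rightarrow> real \<Rightarrow> 'd phase \<Rightarrow> real^'d" where
  "flow_Q g t z0 = fst (snd (snd (flow g t z0)))"

definition flow_P :: "(real^'d \<Rightarrow> real^'d^'d) \<Rightarrow> real \<Rightarrow> 'd phase \<Rightarrow> real^'d" where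
  "flow_P g t z0 = snd (snd (snd (flow g t z0)))"

definition assumption_E :: "(real^'d \<Rightarrow> real^'d^'d) \<Rightarrow> bool" where
  "assumption_E g \<longleftrightarrow>
     (\<exists>t0>0. \<exists>c0>0. \<forall>c\<in>{0<..c0}. \<forall>t\<in>{0<..t0}. \<forall>x0 y0 q0 p0.
        norm y0 \<le> c / t \<longrightarrow> norm q0 \<le> c\<^sup>2 / t\<^sup>2 \<longrightarrow> norm p0 \<le> c^3 / t^3 \<longrightarrow>
        solution_exists g t (x0, y0, q0, p0))"

definition polydisc :: "real \<Rightarrow> real \<Rightarrow> ((real^'d) \<times> (real^'d)) set" where
  "polydisc c t = ball 0 (c\<^sup>2 / t\<^sup>2) \<times> ball 0 (c^3 / t^3)"

definition endpoint_map ::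
  "(real^'d \<Rightarrow> real^'d^'d) \<Rightarrow> real \<Rightarrow> real^'d \<Rightarrow> real^'d
     \<Rightarrow> (real^'d) \<times> (real^'d) \<Rightarrow> (real^'d) \<times> (real^'d)" where
  "endpoint_map g t x0 y0 = (\<lambda>(q0, p0).
     (flow_X g t (x0, y0, q0, p0), flow_Y g t (x0, y0, q0, p0)))"

definition reach_domain ::
  "(real^'d \<Rightarrow> real^'d^'d) \<Rightarrow> real \<Rightarrow> real \<Rightarrow> real^'d \<Rightarrow> real^'d
     \<Rightarrow> ((real^'d) \<times> (real^'d)) set" where
  "reach_domain g r t x0 y0 =
     ball (flow_X g t (x0, y0, 0, 0)) r \<times> ball (flow_Y g t (x0, y0, 0, 0)) (r / t)"

(* The pair (Q_0, P^0)(t, x, y, x0, y0). *)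
definition initial_momenta ::
  "(real^'d \<Rightarrow> real^'d^'d) \<Rightarrow> real \<Rightarrow> real \<Rightarrow> real^'d \<Rightarrow> real^'d \<Rightarrow> real^'d \<Rightarrow> real^'d
     \<Rightarrow> (real^'d) \<times> (real^'d)" where
  "initial_momenta g c t x y x0 y0 =
     (THE w. w \<in> polydisc c t \<and> endpoint_map g t x0 y0 w = (x, y))"

(* Initial phase point of the characteristic joining (x0, y0) to (x, y) in time t. *)
definition joining_point ::
  "(real^'d \<Rightarrow> real^'d^'d) \<Rightarrow> real \<Rightarrow> real \<Rightarrow> real^'d \<Rightarrow> real^'d \<Rightarrow> real^'d \<Rightarrow> real^'d
     \<Rightarrow> 'd phase" where
  "joining_point g c t x y x0 y0 = (x0, y0, initial_momenta g c t x y x0 y0)"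

definition action :: "(real^'d \<Rightarrow> real^'d^'d) \<Rightarrow> real \<Rightarrow> 'd phase \<Rightarrow> real" where
  "action g t z0 = integral {0..t} (\<lambda>s.
       flow_P g s z0 \<bullet> vector_derivative (\<lambda>s'. flow_X g s' z0) (at s within {0..t})
     + flow_Q g s z0 \<bullet> vector_derivative (\<lambda>s'. flow_Y g s' z0) (at s within {0..t})
     - hamiltonian g (flow_X g s z0) (flow_Y g s z0) (flow_Q g s z0) (flow_P g s z0))"

definition two_point_function ::
  "(real^'d \<Rightarrow> real^'d^'d) \<Rightarrow> real \<Rightarrow> real \<Rightarrow> real^'d \<Rightarrow> real^'d \<Rightarrow> real^'d \<Rightarrow> real^'d \<Rightarrow> real" where
  "two_point_function g c t x y x0 y0 = action g t (joining_point g c t x y x0 y0)"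

end

theory Submission
  imports Defs
begin

text \<open>
  Write a phase point as \<open>z = (x, y, q, p)\<close>, let \<open>F\<close> be the Hamiltonian field, and let (in the
  code, \<open>liouville\<close>, or \<open>lam\<close> in the abstract setting)
  \<open>\<lambda>(a, b) = p\<^sub>a \<bullet> x\<^sub>b + q\<^sub>a \<bullet> y\<^sub>b\<close> be the bilinear form behind the Liouville one-form
  \<open>p dx + q dy\<close>. Hamilton's equations say \<open>dH(z) h = \<lambda>(h, F z) - \<lambda>(F z, h)\<close>, and the action is the
  integral of \<open>L(z) = \<lambda>(z, F z) - H z\<close>. If \<open>z\<close> and \<open>z + \<Delta>\<close> are both solutions, then expanding the
  bilinear \<open>\<lambda>\<close> and using the formula for \<open>dH\<close> gives
  \<open>L(z + \<Delta>) - L(z) = d/ds \<lambda>(z, \<Delta>) + O(|\<Delta>|\<^sup>2)\<close>. Integrating, the actions of neighbouring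
  characteristics differ by the boundary terms \<open>\<lambda>(z(t), \<Delta>(t)) - \<lambda>(z(0), \<Delta>(0))\<close> up to
  \<open>O(|\<Delta>(0)|\<^sup>2)\<close> (lemma \<open>trajectory_tube\<close>), where Gronwall's inequality bounds \<open>\<Delta>\<close> by its initial value.

  For the two-point function the final point and the initial point of the compared characteristics
  are prescribed, so the boundary terms are
  \<open>P \<bullet> \<Delta>x + Q \<bullet> \<Delta>y - p\<^sup>0 \<bullet> \<Delta>x\<^sub>0 - q\<^sub>0 \<bullet> \<Delta>y\<^sup>0\<close>: exactly the claimed gradients, and the unknown
  initial momenta occur only in the quadratic error. What remains is that these momenta move by at
  most a constant times the change of the data. If \<open>f\<close> is the endpoint map and \<open>h\<close> a nearby one, a
  solution of \<open>h v = f w\<close> is a fixed point of \<open>v \<mapsto> f\<^sup>-\<^sup>1 (f v - h v + f w)\<close>; Brouwer's theorem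
  provides one, and differentiability of \<open>f\<^sup>-\<^sup>1\<close> at \<open>f w\<close> the linear bound (lemma
  \<open>perturbed_preimage\<close>). Injectivity on the polydisc identifies it with the initial momenta of the
  perturbed problem, which yields lemma \<open>two_point_function_expansion\<close>.

  The Hamilton--Jacobi equation follows by holding the endpoints fixed and moving the final time to
  \<open>s\<close>: up to \<open>O((s - t)\<^sup>2)\<close> the two-point function is the action of the fixed characteristic up to
  \<open>s\<close> plus \<open>P(s) \<bullet> (x - X(s)) + Q(s) \<bullet> (y - Y(s))\<close>, with derivative
  \<open>(P \<bullet> X' + Q \<bullet> Y' - H) - (P \<bullet> X' + Q \<bullet> Y') = - H\<close> at \<open>s = t\<close>.

  Gronwall's inequality needs the Hamiltonian field to be Lipschitz on balls. It is, because the
  Hamiltonian lies in an algebra of functions that is stable under partial derivatives.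
\<close>

section \<open>Functions with partial derivatives in a given algebra\<close>

text \<open>
  Closing a set of functions under ring operations and reciprocals makes the differentiation rules
  a structural induction: if every generator has its partial derivatives in the closure, so has every
  member, and all members are smooth.
\<close>
inductive_set smooth_algebra :: "('a::euclidean_space \<Rightarrow> real) set \<Rightarrow> ('a \<Rightarrow> real) set"
  for B where
  generator: "f \<in> B \<Longrightarrow> f \<in> smooth_algebra B"
| const: "(\<lambda>_. k) \<in> smooth_algebra B"
| add: "f \<in> smooth_algebra B \<Longrightarrow> h \<in> smooth_algebra B \<Longrightarrow> (\<lambda>z. f z + h z) \<in> smooth_algebra B"
| mult: "f \<in> smooth_algebra B \<Longrightarrow> h \<in> smooth_algebra B \<Longrightarrow> (\<lambda>z. f z * h z) \<in> smooth_algebra B"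
| reciprocal: "f \<in> smooth_algebra B \<Longrightarrow> (\<And>z. f z \<noteq> 0) \<Longrightarrow> (\<lambda>z. inverse (f z)) \<in> smooth_algebra B"

definition partials_in :: "('a::euclidean_space \<Rightarrow> real) set \<Rightarrow> ('a \<Rightarrow> real) \<Rightarrow> bool" where
  "partials_in A f \<longleftrightarrow>
     (\<exists>D. (\<forall>z. (f has_derivative (\<lambda>h. D h z)) (at z)) \<and> (\<forall>h. D h \<in> A))"

lemma smooth_algebra_minus:
  assumes "f \<in> smooth_algebra B"
  shows "(\<lambda>z. - f z) \<in> smooth_algebra B"
  using smooth_algebra.mult[OF smooth_algebra.const[of "-1"] assms] by simp

lemma smooth_algebra_sum:
  assumes "\<And>i. i \<in> I \<Longrightarrow> f i \<in> smooth_algebra B"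
  shows "(\<lambda>z. \<Sum>i\<in>I. f i z) \<in> smooth_algebra B"
  using assms
  by (induction I rule: infinite_finite_induct)
     (auto intro: smooth_algebra.const smooth_algebra.add)

lemma smooth_algebra_prod:
  assumes "\<And>i. i \<in> I \<Longrightarrow> f i \<in> smooth_algebra B"
  shows "(\<lambda>z. \<Prod>i\<in>I. f i z) \<in> smooth_algebra B"
  using assms
  by (induction I rule: infinite_finite_induct)
     (auto intro: smooth_algebra.const smooth_algebra.mult)

lemma smooth_algebra_det:
  fixes M :: "'a::euclidean_space \<Rightarrow> real^'n^'n"
  assumes "\<And>i j. (\<lambda>z. M z $ i $ j) \<in> smooth_algebra B"
  shows "(\<lambda>z. det (M z)) \<in> smooth_algebra B"
  unfolding det_def
  by (intro smooth_algebra_sum smooth_algebra_prod smooth_algebra.mult smooth_algebra.const assms)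

text \<open>
  Cramer's rule writes an entry of the inverse matrix as a quotient of determinants, hence as an
  element of the algebra.
\<close>
lemma smooth_algebra_matrix_inv:
  fixes M :: "'a::euclidean_space \<Rightarrow> real^'n^'n"
  assumes M: "\<And>i j. (\<lambda>z. M z $ i $ j) \<in> smooth_algebra B"
    and inv: "\<And>z. invertible (M z)"
  shows "(\<lambda>z. matrix_inv (M z) $ i $ j) \<in> smooth_algebra B"
proof -
  \<comment> \<open>The matrix of Cramer's rule: column \<open>i\<close> is replaced by the \<open>j\<close>-th unit vector.\<close>
  let ?N = "\<lambda>z. (\<chi> k l. if l = i then axis j 1 $ k else M z $ k $ l) :: real^'n^'n"
  have "matrix_inv (M z) $ i $ j = det (?N z) * inverse (det (M z))" for z
  proof -
    have "M z ** matrix_inv (M z) = mat 1"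
      unfolding matrix_inv_def using someI_ex[OF inv[of z, unfolded invertible_def]] by blast
    then have "M z *v (matrix_inv (M z) *v axis j 1) = axis j 1"
      by (simp add: matrix_vector_mul_assoc)
    then have "matrix_inv (M z) *v axis j 1 =
        (\<chi> i. det (\<chi> k l. if l = i then axis j 1 $ k else M z $ k $ l) / det (M z))"
      using inv[of z] by (subst (asm) cramer) (auto simp: invertible_det_nz)
    moreover have "(matrix_inv (M z) *v axis j 1) $ i = matrix_inv (M z) $ i $ j"
      by (simp add: matrix_vector_mult_basis column_def)
    ultimately show ?thesis by (simp add: divide_inverse)
  qed
  moreover have "(\<lambda>z. det (?N z) * inverse (det (M z))) \<in> smooth_algebra B"
  proof (intro smooth_algebra.mult smooth_algebra.reciprocal smooth_algebra_det M)
    show "(\<lambda>z. ?N z $ k $ l) \<in> smooth_algebra B" for k l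
      by (cases "l = i") (auto intro: smooth_algebra.const M)
    show "det (M z) \<noteq> 0" for z
      using inv[of z] by (simp add: invertible_det_nz)
  qed
  ultimately show ?thesis by simp
qed

lemma smooth_algebra_partials:
  assumes gen: "\<And>f. f \<in> B \<Longrightarrow> partials_in (smooth_algebra B) f"
    and "f \<in> smooth_algebra B"
  shows "partials_in (smooth_algebra B) f"
  using assms(2)
proof induction
  case (generator f)
  then show ?case by (rule gen)
next
  case (const k)
  show ?case unfolding partials_in_def
    by (rule exI[of _ "\<lambda>_ _. 0"]) (auto intro: smooth_algebra.const)
next
  case (add f h)
  then obtain D E where D: "\<And>z. (f has_derivative (\<lambda>k. D k z)) (at z)" "\<And>k. D k \<in> smooth_algebra B"
    and E: "\<And>z. (h has_derivative (\<lambda>k. E k z)) (at z)" "\<And>k. E k \<in> smooth_algebra B"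
    unfolding partials_in_def by blast
  then show ?case unfolding partials_in_def
    by (intro exI[of _ "\<lambda>k z. D k z + E k z"] conjI allI smooth_algebra.add)
       (auto intro!: derivative_eq_intros)
next
  case (mult f h)
  then obtain D E where D: "\<And>z. (f has_derivative (\<lambda>k. D k z)) (at z)" "\<And>k. D k \<in> smooth_algebra B"
    and E: "\<And>z. (h has_derivative (\<lambda>k. E k z)) (at z)" "\<And>k. E k \<in> smooth_algebra B"
    unfolding partials_in_def by blast
  then show ?case unfolding partials_in_def using mult.hyps
    by (intro exI[of _ "\<lambda>k z. f z * E k z + D k z * h z"] conjI allI)
       (auto intro: has_derivative_mult intro!: smooth_algebra.add smooth_algebra.mult)
next
  case (reciprocal f)
  then obtain D where D: "\<And>z. (f has_derivative (\<lambda>k. D k z)) (at z)" "\<And>k. D k \<in> smooth_algebra B"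
    unfolding partials_in_def by blast
  then show ?case unfolding partials_in_def using reciprocal.hyps
    by (intro exI[of _ "\<lambda>k z. - (inverse (f z) * D k z * inverse (f z))"] conjI allI)
       (auto intro!: smooth_algebra_minus smooth_algebra.mult smooth_algebra.reciprocal Deriv.has_derivative_inverse)
qed

text \<open>
  The partial derivatives of \<open>f\<close> are members of \<open>A\<close>, therefore differentiable, continuous and bounded
  on the compact ball; this bounds the operator norm of the derivative of \<open>f\<close> there.
\<close>
lemma partials_in_lipschitz_on_ball:
  assumes f: "partials_in A f" and A: "\<And>h. h \<in> A \<Longrightarrow> partials_in A h"
  shows "\<exists>K\<ge>0. \<forall>u\<in>cball 0 R. \<forall>v\<in>cball 0 R. \<bar>f u - f v\<bar> \<le> K * norm (u - v)"
proof -
  obtain D where D: "\<And>z. (f has_derivative (\<lambda>h. D h z)) (at z)" "\<And>h. D h \<in> A"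
    using f unfolding partials_in_def by blast
  have "\<exists>k. \<forall>z\<in>cball 0 R. \<bar>D h z\<bar> \<le> k" for h
  proof -
    have "continuous_on (cball 0 R) (D h)"
      using A[OF D(2)[of h]] unfolding partials_in_def
      by (meson continuous_at_imp_continuous_on has_derivative_continuous)
    then have "bounded (D h ` cball 0 R)"
      using compact_cball compact_continuous_image compact_imp_bounded by blast
    then show ?thesis unfolding bounded_iff by auto
  qed
  then obtain k where k: "\<And>h z. z \<in> cball 0 R \<Longrightarrow> \<bar>D h z\<bar> \<le> k h" by metis
  define K where "K = (\<Sum>b\<in>Basis. \<bar>k b\<bar>)"
  have "onorm (\<lambda>h. D h z) \<le> K" if "z \<in> cball 0 R" for z
  proof (rule onorm_le)
    fix h :: 'a
    interpret l: linear "\<lambda>h. D h z" using D(1)[of z] by (rule has_derivative_linear)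
    have "D h z = D (\<Sum>b\<in>Basis. (h \<bullet> b) *\<^sub>R b) z" by (simp add: euclidean_representation)
    also have "\<dots> = (\<Sum>b\<in>Basis. (h \<bullet> b) * D b z)" by (simp add: l.sum l.scale)
    also have "\<bar>\<dots>\<bar> \<le> (\<Sum>b\<in>Basis. norm h * \<bar>k b\<bar>)"
    proof (intro order.trans[OF sum_abs] sum_mono)
      fix b :: 'a assume "b \<in> Basis"
      then show "\<bar>(h \<bullet> b) * D b z\<bar> \<le> norm h * \<bar>k b\<bar>"
        unfolding abs_mult using k[OF that, of b] Basis_le_norm[of b h]
        by (intro mult_mono) auto
    qed
    finally show "norm (D h z) \<le> K * norm h"
      by (simp add: K_def sum_distrib_left mult.commute)
  qed
  then have "norm (f u - f v) \<le> K * norm (u - v)" if "u \<in> cball 0 R" "v \<in> cball 0 R" for u v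
    using that D(1)
    by (intro differentiable_bound[of "cball 0 R" f "\<lambda>z h. D h z"])
       (auto intro: has_derivative_at_withinI)
  moreover have "K \<ge> 0" unfolding K_def by (simp add: sum_nonneg)
  ultimately show ?thesis by auto
qed

section \<open>Gradients and second-order errors\<close>

lemma has_derivative_imp_gradient:
  assumes "(f has_derivative f') (at x)"
  shows "gradient f x \<bullet> h = f' h"
proof -
  have lin: "linear f'" using assms by (rule has_derivative_linear)
  have "frechet_derivative f (at x) = f'" using frechet_derivative_at[OF assms] by simp
  then have "gradient f x \<bullet> h = (\<Sum>i\<in>UNIV. h $ i * f' (axis i 1))"
    by (simp add: gradient_def inner_vec_def mult.commute)
  also have "\<dots> = f' (\<Sum>i\<in>UNIV. h $ i *\<^sub>R axis i 1)"
    using lin by (simp add: linear_sum linear_cmul)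
  also have "(\<Sum>i\<in>UNIV. h $ i *\<^sub>R axis i 1) = h"
    using basis_expansion[of h] by (simp add: scalar_mult_eq_scaleR)
  finally show ?thesis .
qed

lemma gderiv_imp_gradient:
  assumes "GDERIV f x :> v"
  shows "gradient f x = v"
  using has_derivative_imp_gradient[OF assms[unfolded gderiv_def]]
  by (metis inner_commute vector_eq_ldot)

lemma quadratic_error_imp_has_derivative:
  assumes "bounded_linear f'" and "\<delta> > 0"
    and err: "\<And>x'. x' \<in> S \<Longrightarrow> norm (x' - x) < \<delta> \<Longrightarrow> norm (f x' - f x - f' (x' - x)) \<le> K * (norm (x' - x))\<^sup>2"
  shows "(f has_derivative f') (at x within S)"
  unfolding has_derivative_within_alt
proof (intro conjI allI impI)
  show "bounded_linear f'" by fact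
  fix e :: real assume "e > 0"
  show "\<exists>d>0. \<forall>y\<in>S. norm (y - x) < d \<longrightarrow> norm (f y - f x - f' (y - x)) \<le> e * norm (y - x)"
  proof (intro exI[of _ "min \<delta> (e / (\<bar>K\<bar> + 1))"] conjI ballI impI)
    show "0 < min \<delta> (e / (\<bar>K\<bar> + 1))" using \<open>\<delta> > 0\<close> \<open>e > 0\<close> by simp
    fix y assume y: "y \<in> S" "norm (y - x) < min \<delta> (e / (\<bar>K\<bar> + 1))"
    have "(\<bar>K\<bar> + 1) * norm (y - x) \<le> e" using y by (simp add: field_simps)
    moreover have "K * norm (y - x) \<le> (\<bar>K\<bar> + 1) * norm (y - x)" by (intro mult_right_mono) auto
    ultimately have "K * norm (y - x) * norm (y - x) \<le> e * norm (y - x)"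
      by (intro mult_right_mono) auto
    then show "norm (f y - f x - f' (y - x)) \<le> e * norm (y - x)"
      using err[of y] y by (simp add: power2_eq_square mult.assoc)
  qed
qed

section \<open>First variation of the action\<close>

text \<open>
  The calculus of variations below uses only that the symplectic form is the antisymmetrisation of a
  bounded bilinear form \<open>lam\<close>: the assumption \<open>derivative\<close> is Hamilton's system for \<open>F\<close>, written without
  coordinates.
\<close>
locale exact_hamiltonian_system =
  fixes lam :: "'z::euclidean_space \<Rightarrow> 'z \<Rightarrow> real" and H :: "'z \<Rightarrow> real" and F :: "'z \<Rightarrow> 'z"
  assumes bilinear: "bounded_bilinear lam"
    and lipschitz: "\<exists>K\<ge>0. \<forall>u\<in>cball 0 R. \<forall>v\<in>cball 0 R. norm (F u - F v) \<le> K * norm (u - v)"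
    and derivative: "(H has_derivative (\<lambda>h. lam h (F z) - lam (F z) h)) (at z)"
begin

interpretation lam: bounded_bilinear lam by (rule bilinear)

definition sol :: "real \<Rightarrow> (real \<Rightarrow> 'z) \<Rightarrow> bool" where
  "sol T z \<longleftrightarrow> (\<forall>s\<in>{0..T}. (z has_vector_derivative F (z s)) (at s within {0..T}))"

definition lagrangian :: "'z \<Rightarrow> real" where
  "lagrangian z = lam z (F z) - H z"

lemma sol_subset: "sol T z \<Longrightarrow> \<tau> \<le> T \<Longrightarrow> sol \<tau> z"
  unfolding sol_def by (fastforce elim: has_vector_derivative_within_subset)

lemma sol_continuous_on: "sol T z \<Longrightarrow> continuous_on {0..T} z"
  unfolding sol_def continuous_on_eq_continuous_within
  using has_vector_derivative_continuous by blast

lemma continuous_on_F: "continuous_on UNIV F"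
proof (rule continuous_at_imp_continuous_on, rule ballI)
  fix z :: 'z
  obtain K where K: "K \<ge> 0" "\<And>u v. u \<in> cball 0 (norm z + 1) \<Longrightarrow> v \<in> cball 0 (norm z + 1) \<Longrightarrow>
      norm (F u - F v) \<le> K * norm (u - v)"
    using lipschitz by meson
  have "K-lipschitz_on (ball 0 (norm z + 1)) F"
    using K by (auto intro!: lipschitz_onI simp: dist_norm)
  then have "continuous_on (ball 0 (norm z + 1)) F" by (rule lipschitz_on_continuous_on)
  then show "isCont F z" by (simp add: continuous_on_eq_continuous_at)
qed

text \<open>
  The function \<open>exp (- 2 K s) |z1 s - z2 s|\<^sup>2\<close> is nonincreasing as long as both solutions stay in a set
  on which \<open>F\<close> is \<open>K\<close>-Lipschitz.
\<close>
lemma gronwall: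
  assumes K: "\<And>u v. u \<in> X \<Longrightarrow> v \<in> X \<Longrightarrow> norm (F u - F v) \<le> K * norm (u - v)"
    and sols: "sol \<tau> z1" "sol \<tau> z2"
    and X: "\<And>s. s \<in> {0..\<tau>} \<Longrightarrow> z1 s \<in> X" "\<And>s. s \<in> {0..\<tau>} \<Longrightarrow> z2 s \<in> X"
    and "0 \<le> \<tau>"
  shows "norm (z1 \<tau> - z2 \<tau>) \<le> exp (K * \<tau>) * norm (z1 0 - z2 0)"
proof -
  define \<Delta> where "\<Delta> = (\<lambda>s. z1 s - z2 s)"
  define \<phi> where "\<phi> = (\<lambda>s. exp (- 2 * K * s) * (\<Delta> s \<bullet> \<Delta> s))"
  have cont: "continuous_on {0..\<tau>} \<phi>" unfolding \<phi>_def \<Delta>_def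
    by (intro continuous_intros sol_continuous_on sols)
  have "\<phi> \<tau> \<le> \<phi> 0"
  proof (rule DERIV_nonpos_imp_decreasing_open[OF \<open>0 \<le> \<tau>\<close> _ cont])
    fix s assume s: "0 < s" "s < \<tau>"
    let ?d = "F (z1 s) - F (z2 s)"
    have d: "(\<Delta> has_vector_derivative ?d) (at s)"
      using sols s unfolding sol_def \<Delta>_def at_within_Icc_at[OF s, symmetric]
      by (auto intro!: has_vector_derivative_diff)
    have "(\<phi> has_real_derivative
        exp (- 2 * K * s) * (2 * (\<Delta> s \<bullet> ?d)) - 2 * K * exp (- 2 * K * s) * (\<Delta> s \<bullet> \<Delta> s)) (at s)"
      using d unfolding \<phi>_def has_field_derivative_def has_vector_derivative_def
      by (auto intro!: derivative_eq_intros simp: fun_eq_iff algebra_simps inner_commute)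
    moreover have "\<Delta> s \<bullet> ?d \<le> K * (\<Delta> s \<bullet> \<Delta> s)"
    proof -
      have "\<Delta> s \<bullet> ?d \<le> norm (\<Delta> s) * norm ?d" by (rule norm_cauchy_schwarz)
      also have "\<dots> \<le> norm (\<Delta> s) * (K * norm (\<Delta> s))"
        using K[OF X(1) X(2), of s s] s unfolding \<Delta>_def by (intro mult_left_mono) auto
      finally show ?thesis by (simp add: dot_square_norm power2_eq_square algebra_simps)
    qed
    then have "exp (- 2 * K * s) * (2 * (\<Delta> s \<bullet> ?d)) - 2 * K * exp (- 2 * K * s) * (\<Delta> s \<bullet> \<Delta> s) \<le> 0"
      using mult_left_mono[of "\<Delta> s \<bullet> ?d" "K * (\<Delta> s \<bullet> \<Delta> s)" "2 * exp (- 2 * K * s)"]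
      by (simp add: mult.assoc mult.left_commute)
    ultimately show "\<exists>y. (\<phi> has_real_derivative y) (at s) \<and> y \<le> 0" by blast
  qed
  then have "exp (- 2 * K * \<tau>) * (norm (\<Delta> \<tau>))\<^sup>2 \<le> (norm (\<Delta> 0))\<^sup>2"
    by (simp add: \<phi>_def dot_square_norm)
  then have "exp (2 * K * \<tau>) * (exp (- 2 * K * \<tau>) * (norm (\<Delta> \<tau>))\<^sup>2)
      \<le> exp (2 * K * \<tau>) * (norm (\<Delta> 0))\<^sup>2"
    by (intro mult_left_mono) auto
  then have "(norm (\<Delta> \<tau>))\<^sup>2 \<le> exp (2 * K * \<tau>) * (norm (\<Delta> 0))\<^sup>2"
    by (simp add: mult.assoc[symmetric] exp_add[symmetric])
  also have "\<dots> = (exp (K * \<tau>) * norm (\<Delta> 0))\<^sup>2"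
    by (simp add: power_mult_distrib power2_eq_square exp_add[symmetric])
  finally show ?thesis unfolding \<Delta>_def
    by (rule power2_le_imp_le) simp
qed

text \<open>
  A continuation argument: at the first time at which the distance is 1 both solutions have stayed
  in the ball of radius \<open>R\<close>, where Gronwall's inequality keeps the distance below 1.
\<close>
lemma stays_close:
  assumes K: "\<And>u v. u \<in> cball 0 R \<Longrightarrow> v \<in> cball 0 R \<Longrightarrow> norm (F u - F v) \<le> K * norm (u - v)"
    and "K \<ge> 0" and z: "sol T z" "\<And>s. s \<in> {0..T} \<Longrightarrow> norm (z s) \<le> R - 1"
    and z1: "sol \<tau> z1" "\<tau> \<le> T" and close: "exp (K * T) * norm (z1 0 - z 0) < 1"
    and s: "s \<in> {0..\<tau>}"
  shows "norm (z1 s - z s) < 1"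
proof (rule ccontr)
  define \<delta> where "\<delta> = (\<lambda>u. norm (z1 u - z u))"
  have cont: "continuous_on {0..\<tau>} \<delta>" unfolding \<delta>_def
    using sol_subset[OF z(1) z1(2)] z1 by (intro continuous_intros sol_continuous_on)
  have "0 \<le> T" using s z1 by auto
  then have "1 * \<delta> 0 \<le> exp (K * T) * \<delta> 0"
    using \<open>K \<ge> 0\<close> by (intro mult_right_mono) (auto simp: \<delta>_def)
  then have \<delta>0: "\<delta> 0 < 1" using close by (simp add: \<delta>_def)
  have hits: "\<exists>v. 0 \<le> v \<and> v \<le> u \<and> \<delta> v = 1" if "0 \<le> u" "u \<le> \<tau>" "\<delta> u \<ge> 1" for u
    using \<delta>0 that by (intro IVT' continuous_on_subset[OF cont]) auto
  let ?E = "{u \<in> {0..\<tau>}. \<delta> u = 1}"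
  assume "\<not> norm (z1 s - z s) < 1"
  then have "?E \<noteq> {}" using s hits[of s] unfolding \<delta>_def by fastforce
  moreover have "compact ?E"
    using continuous_closed_preimage_constant[OF cont, of 1]
    by (simp add: compact_eq_bounded_closed bounded_subset[OF bounded_closed_interval[of 0 \<tau>]] subset_iff)
  ultimately obtain e where e: "e \<in> ?E" "\<And>u. u \<in> ?E \<Longrightarrow> e \<le> u"
    using compact_attains_inf[of ?E] by blast
  have le1: "\<delta> u \<le> 1" if u: "u \<in> {0..e}" for u
  proof (rule ccontr)
    assume "\<not> \<delta> u \<le> 1"
    then obtain v where v: "0 \<le> v" "v \<le> u" "\<delta> v = 1"
      using hits[of u] u e(1) by auto
    then have "e \<le> v" using e u by auto
    then have "u = v" using v u by auto
    then show False using v \<open>\<not> \<delta> u \<le> 1\<close> by simp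
  qed
  have "norm (z1 e - z e) \<le> exp (K * e) * norm (z1 0 - z 0)"
  proof (rule gronwall[where X = "cball 0 R", OF K])
    show "sol e z1" "sol e z" using e z1 z by (auto intro: sol_subset)
    fix u assume u: "u \<in> {0..e}"
    have "norm (z u) \<le> R - 1" using u e z1 by (intro z) auto
    moreover have "norm (z1 u) \<le> norm (z1 u - z u) + norm (z u)"
      using norm_triangle_ineq[of "z1 u - z u" "z u"] by simp
    ultimately show "z1 u \<in> cball 0 R" "z u \<in> cball 0 R" using le1[OF u] by (auto simp: \<delta>_def)
  qed (use e in auto)
  also have "\<dots> \<le> exp (K * T) * norm (z1 0 - z 0)"
    using e z1 \<open>K \<ge> 0\<close> by (intro mult_right_mono) (auto intro: mult_left_mono)
  finally show False using close e by (simp add: \<delta>_def)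
qed

lemma continuous_on_lagrangian: "continuous_on UNIV lagrangian"
  unfolding lagrangian_def
  by (intro continuous_intros lam.continuous_on continuous_on_F
        continuous_at_imp_continuous_on ballI has_derivative_continuous[OF derivative])

text \<open>
  The first variation of the Lagrangian. For \<open>u = z s\<close> and \<open>v = z1 s\<close> on two solutions, the linear part
  \<open>lam u (F v - F u) + lam (F u) (v - u)\<close> is the time derivative of \<open>lam z (z1 - z)\<close>. The remainder is
  \<open>lam (v - u) (F v - F u)\<close> minus the linearisation error of \<open>H\<close>, and both are quadratic because \<open>F\<close>,
  and with it the derivative of \<open>H\<close>, is Lipschitz on balls.
\<close>
lemma lagrangian_expansion:
  "\<exists>C\<ge>0. \<forall>u\<in>cball 0 R. \<forall>v\<in>cball 0 R.
     \<bar>lagrangian v - lagrangian u - (lam u (F v - F u) + lam (F u) (v - u))\<bar> \<le> C * (norm (v - u))\<^sup>2"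
proof -
  obtain M where M: "M > 0" "\<And>a b. norm (lam a b) \<le> norm a * norm b * M"
    using lam.pos_bounded by blast
  obtain K where K: "K \<ge> 0" "\<And>u v. u \<in> cball 0 R \<Longrightarrow> v \<in> cball 0 R \<Longrightarrow> norm (F u - F v) \<le> K * norm (u - v)"
    using lipschitz by meson
  have "\<bar>lagrangian v - lagrangian u - (lam u (F v - F u) + lam (F u) (v - u))\<bar>
      \<le> 3 * M * K * (norm (v - u))\<^sup>2" if uv: "u \<in> cball 0 R" "v \<in> cball 0 R" for u v
  proof -
    have "norm (lam (v - u) (F v - F u)) \<le> norm (v - u) * norm (F v - F u) * M" by (rule M)
    also have "\<dots> \<le> norm (v - u) * (K * norm (v - u)) * M"
      using K(2)[OF uv(2,1)] M(1) by (intro mult_right_mono mult_left_mono) auto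
    finally have 1: "\<bar>lam (v - u) (F v - F u)\<bar> \<le> M * K * (norm (v - u))\<^sup>2"
      by (simp add: power2_eq_square algebra_simps)
    have "norm (H v - H u - (lam (v - u) (F u) - lam (F u) (v - u)))
        \<le> norm (v - u) * (2 * M * K * norm (v - u))"
    proof (rule differentiable_bound_linearization[where S = "closed_segment u v"
          and f' = "\<lambda>z h. lam h (F z) - lam (F z) h"])
      show "u + t *\<^sub>R (v - u) \<in> closed_segment u v" if "t \<in> {0..1}" for t
        using that unfolding in_segment by (auto intro!: exI[of _ t] simp: algebra_simps)
      show "(H has_derivative (\<lambda>h. lam h (F z) - lam (F z) h)) (at z within closed_segment u v)" for z
        by (rule has_derivative_at_withinI[OF derivative])
      show "onorm ((\<lambda>h. lam h (F z) - lam (F z) h) - (\<lambda>h. lam h (F u) - lam (F u) h))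
          \<le> 2 * M * K * norm (v - u)" if z: "z \<in> closed_segment u v" for z
      proof (rule onorm_le)
        fix h
        have zR: "z \<in> cball 0 R"
          using z uv closed_segment_subset[OF uv convex_cball] by blast
        have "norm (F z - F u) \<le> K * norm (z - u)" using K(2)[OF zR uv(1)] .
        also have "\<dots> \<le> K * norm (v - u)"
          using segment_bound1[OF z] K(1) by (intro mult_left_mono) auto
        finally have Fz: "norm (F z - F u) \<le> K * norm (v - u)" .
        have "norm (lam h (F z - F u) - lam (F z - F u) h) \<le>
            norm h * norm (F z - F u) * M + norm (F z - F u) * norm h * M"
          using M(2)[of h "F z - F u"] M(2)[of "F z - F u" h]
            norm_triangle_ineq4[of "lam h (F z - F u)" "lam (F z - F u) h"] by linarith
        also have "\<dots> = 2 * (norm h * M) * norm (F z - F u)" by simp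
        also have "\<dots> \<le> 2 * (norm h * M) * (K * norm (v - u))"
          using Fz M(1) by (intro mult_left_mono) auto
        finally show "norm (((\<lambda>h. lam h (F z) - lam (F z) h) - (\<lambda>h. lam h (F u) - lam (F u) h)) h)
            \<le> 2 * M * K * norm (v - u) * norm h"
          by (simp add: lam.diff_left lam.diff_right algebra_simps)
      qed
    qed auto
    then have 2: "\<bar>H v - H u - (lam (v - u) (F u) - lam (F u) (v - u))\<bar> \<le> 2 * M * K * (norm (v - u))\<^sup>2"
      by (simp add: power2_eq_square algebra_simps)
    have "lagrangian v - lagrangian u - (lam u (F v - F u) + lam (F u) (v - u))
        = lam (v - u) (F v - F u) - (H v - H u - (lam (v - u) (F u) - lam (F u) (v - u)))"
      by (simp add: lagrangian_def lam.diff_left lam.diff_right algebra_simps)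
    then show ?thesis using 1 2 by linarith
  qed
  moreover have "3 * M * K \<ge> 0" using M K by simp
  ultimately show ?thesis by blast
qed

definition act :: "(real \<Rightarrow> 'z) \<Rightarrow> real \<Rightarrow> real" where
  "act z \<tau> = integral {0..\<tau>} (\<lambda>s. lagrangian (z s))"

lemma lagrangian_has_integral:
  assumes "sol \<tau> z"
  shows "((\<lambda>s. lagrangian (z s)) has_integral act z \<tau>) {0..\<tau>}"
proof -
  have "continuous_on {0..\<tau>} (\<lambda>s. lagrangian (z s))"
    using continuous_on_compose2[OF continuous_on_lagrangian sol_continuous_on[OF assms]] by simp
  then show ?thesis
    unfolding act_def by (rule integrable_integral[OF integrable_continuous_interval])
qed

lemma act_has_derivative:
  assumes "sol T z" "s \<in> {0..T}"
  shows "(act z has_real_derivative lagrangian (z s)) (at s within {0..T})"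
  unfolding act_def using assms sol_continuous_on[OF assms(1)]
  by (intro integral_has_real_derivative continuous_on_compose2[OF continuous_on_lagrangian]) auto

text \<open>
  All solutions that start near a given trajectory stay in one ball, so a single constant serves
  for the Lipschitz dependence on initial value and time and for the first variation of the action.
  The comparison solutions may live on shorter intervals than \<open>z\<close>, since two-point problems with
  different final times have to be compared. Integrating \<open>lagrangian_expansion\<close> turns its linear part into
  the boundary terms of the second estimate.
\<close>
lemma trajectory_tube:
  assumes z: "sol T z" and "0 \<le> T"
  obtains \<delta> K where "\<delta> > 0" "K \<ge> 0"
    "\<And>\<tau> \<tau>' z1 z2. sol \<tau> z1 \<Longrightarrow> sol \<tau>' z2 \<Longrightarrow> \<tau> \<in> {0..T} \<Longrightarrow> \<tau>' \<in> {0..T} \<Longrightarrow>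
      norm (z1 0 - z 0) < \<delta> \<Longrightarrow> norm (z2 0 - z 0) < \<delta> \<Longrightarrow>
      norm (z1 \<tau> - z2 \<tau>') \<le> K * (norm (z1 0 - z2 0) + \<bar>\<tau> - \<tau>'\<bar>)"
    "\<And>\<tau> z1. sol \<tau> z1 \<Longrightarrow> \<tau> \<in> {0..T} \<Longrightarrow> norm (z1 0 - z 0) < \<delta> \<Longrightarrow>
      \<bar>act z1 \<tau> - act z \<tau> - (lam (z \<tau>) (z1 \<tau> - z \<tau>) - lam (z 0) (z1 0 - z 0))\<bar>
        \<le> K * (norm (z1 0 - z 0))\<^sup>2"
proof -
  have "bounded (z ` {0..T})"
    using compact_continuous_image[OF sol_continuous_on[OF z]] compact_imp_bounded by blast
  then obtain r where r: "\<And>s. s \<in> {0..T} \<Longrightarrow> norm (z s) \<le> r"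
    unfolding bounded_iff by (meson imageI)
  define R where "R = r + 1"
  obtain k where k: "k \<ge> 0" "\<And>u v. u \<in> cball 0 R \<Longrightarrow> v \<in> cball 0 R \<Longrightarrow> norm (F u - F v) \<le> k * norm (u - v)"
    using lipschitz by meson
  obtain C where C: "C \<ge> 0" "\<And>u v. u \<in> cball 0 R \<Longrightarrow> v \<in> cball 0 R \<Longrightarrow>
     \<bar>lagrangian v - lagrangian u - (lam u (F v - F u) + lam (F u) (v - u))\<bar> \<le> C * (norm (v - u))\<^sup>2"
    using lagrangian_expansion by meson
  have "bounded (F ` cball 0 R)"
    using compact_continuous_image[OF continuous_on_subset[OF continuous_on_F] compact_cball]
      compact_imp_bounded by blast
  then obtain B where B: "B > 0" "\<And>u. u \<in> cball 0 R \<Longrightarrow> norm (F u) \<le> B"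
    unfolding bounded_pos by auto
  define E where "E = exp (k * T)"
  have E: "E > 0" "\<And>s. s \<le> T \<Longrightarrow> exp (k * s) \<le> E"
    using k(1) by (auto simp: E_def mult_left_mono)
  have inR: "z1 s \<in> cball 0 R" if "sol \<tau> z1" "\<tau> \<le> T" "norm (z1 0 - z 0) < 1 / E" "s \<in> {0..\<tau>}" for z1 \<tau> s
  proof -
    have "norm (z1 s - z s) < 1"
      using that E(1)
      by (intro stays_close[OF k(2) k(1) z, of R]) (auto simp: R_def r E_def field_simps)
    moreover have "norm (z1 s) \<le> norm (z1 s - z s) + norm (z s)"
      using norm_triangle_ineq[of "z1 s - z s" "z s"] by simp
    ultimately show ?thesis using r[of s] that by (simp add: R_def)
  qed
  have zR: "z s \<in> cball 0 R" if "s \<in> {0..T}" for s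
    using r[OF that] by (simp add: R_def)
  have space: "norm (z1 s - z2 s) \<le> E * norm (z1 0 - z2 0)"
    if "sol s z1" "sol s z2" "s \<in> {0..T}" "norm (z1 0 - z 0) < 1 / E" "norm (z2 0 - z 0) < 1 / E" for z1 z2 s
  proof -
    have "norm (z1 s - z2 s) \<le> exp (k * s) * norm (z1 0 - z2 0)"
      using that inR[of s z1] inR[of s z2]
      by (intro gronwall[where X = "cball 0 R", OF k(2)]) auto
    also have "\<dots> \<le> E * norm (z1 0 - z2 0)" using E(2) that by (intro mult_right_mono) auto
    finally show ?thesis .
  qed
  have time: "norm (z1 \<tau> - z1 s) \<le> B * \<bar>\<tau> - s\<bar>"
    if "sol \<tau> z1" "\<tau> \<le> T" "norm (z1 0 - z 0) < 1 / E" "s \<in> {0..\<tau>}" for z1 \<tau> s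
  proof -
    have "norm (z1 \<tau> - z1 s) \<le> B * norm (\<tau> - s)"
    proof (rule differentiable_bound[of "{0..\<tau>}" z1 "\<lambda>s h. h *\<^sub>R F (z1 s)"])
      show "(z1 has_derivative (\<lambda>h. h *\<^sub>R F (z1 u))) (at u within {0..\<tau>})" if "u \<in> {0..\<tau>}" for u
        using \<open>sol \<tau> z1\<close> that unfolding sol_def has_vector_derivative_def by blast
      show "onorm (\<lambda>h. h *\<^sub>R F (z1 u)) \<le> B" if "u \<in> {0..\<tau>}" for u
        using B(2)[OF inR[OF \<open>sol \<tau> z1\<close> \<open>\<tau> \<le> T\<close> \<open>norm (z1 0 - z 0) < 1 / E\<close> that]]
        by (intro onorm_le) (simp add: mult.commute[of B] mult_left_mono)
    qed (use that in auto)
    then show ?thesis by simp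
  qed
  define K where "K = max (max E (2 * B)) (C * E\<^sup>2 * T)"
  have K: "E \<le> K" "2 * B \<le> K" "C * E\<^sup>2 * T \<le> K" by (auto simp: K_def)
  show thesis
  proof (rule that[of "1 / E" K])
    show "1 / E > 0" "K \<ge> 0" using E(1) K(1) by auto
  next
    fix \<tau> \<tau>' z1 z2
    assume *: "sol \<tau> z1" "sol \<tau>' z2" "\<tau> \<in> {0..T}" "\<tau>' \<in> {0..T}"
      "norm (z1 0 - z 0) < 1 / E" "norm (z2 0 - z 0) < 1 / E"
    \<comment> \<open>Compare the two solutions at a time at which both exist.\<close>
    define m where "m = min \<tau> \<tau>'"
    have m: "m \<in> {0..\<tau>}" "m \<in> {0..\<tau>'}" "m \<in> {0..T}" using * by (auto simp: m_def)
    have "norm (z1 \<tau> - z2 \<tau>') \<le> norm (z1 \<tau> - z1 m) + norm (z1 m - z2 m) + norm (z2 \<tau>' - z2 m)"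
      using norm_triangle_ineq4[of "z1 \<tau> - z1 m + (z1 m - z2 m)" "z2 \<tau>' - z2 m"]
        norm_triangle_ineq[of "z1 \<tau> - z1 m" "z1 m - z2 m"] by (simp add: algebra_simps)
    also have "norm (z1 \<tau> - z1 m) \<le> B * \<bar>\<tau> - m\<bar>" using * m by (intro time) auto
    also have "norm (z2 \<tau>' - z2 m) \<le> B * \<bar>\<tau>' - m\<bar>" using * m by (intro time) auto
    also have "norm (z1 m - z2 m) \<le> E * norm (z1 0 - z2 0)"
      using * m by (intro space) (auto intro: sol_subset)
    also have "B * \<bar>\<tau> - m\<bar> + E * norm (z1 0 - z2 0) + B * \<bar>\<tau>' - m\<bar>
        \<le> 2 * B * \<bar>\<tau> - \<tau>'\<bar> + E * norm (z1 0 - z2 0)"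
      using B(1) by (auto simp: m_def min_def abs_if algebra_simps)
    also have "\<dots> \<le> K * \<bar>\<tau> - \<tau>'\<bar> + K * norm (z1 0 - z2 0)"
      using K by (intro add_mono mult_right_mono) auto
    finally show "norm (z1 \<tau> - z2 \<tau>') \<le> K * (norm (z1 0 - z2 0) + \<bar>\<tau> - \<tau>'\<bar>)"
      by (simp add: algebra_simps)
  next
    fix \<tau> z1
    assume *: "sol \<tau> z1" "\<tau> \<in> {0..T}" "norm (z1 0 - z 0) < 1 / E"
    have z\<tau>: "sol \<tau> z" using sol_subset[OF z] * by auto
    define w where "w = (\<lambda>s. lam (z s) (z1 s - z s))"
    define w' where "w' = (\<lambda>s. lam (z s) (F (z1 s) - F (z s)) + lam (F (z s)) (z1 s - z s))"
    have "(w has_vector_derivative w' s) (at s within {0..\<tau>})" if "s \<in> {0..\<tau>}" for s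
      using z\<tau> *(1) that unfolding sol_def w_def w'_def
      by (intro lam.has_vector_derivative has_vector_derivative_diff) auto
    then have "(w' has_integral w \<tau> - w 0) {0..\<tau>}"
      using * by (intro fundamental_theorem_of_calculus) auto
    then have int: "((\<lambda>s. lagrangian (z1 s) - lagrangian (z s) - w' s) has_integral
        act z1 \<tau> - act z \<tau> - (w \<tau> - w 0)) {0..\<tau>}"
      by (intro has_integral_diff lagrangian_has_integral * z\<tau>)
    have "norm (act z1 \<tau> - act z \<tau> - (w \<tau> - w 0))
        \<le> C * (E * norm (z1 0 - z 0))\<^sup>2 * Henstock_Kurzweil_Integration.content {0..\<tau>}"
    proof (rule has_integral_bound_real[OF _ _ int])
      show "0 \<le> C * (E * norm (z1 0 - z 0))\<^sup>2" using C(1) by simp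
      fix s assume "s \<in> {0..\<tau>} - {}"
      then have s: "s \<in> {0..\<tau>}" by simp
      have "\<bar>lagrangian (z1 s) - lagrangian (z s) - w' s\<bar> \<le> C * (norm (z1 s - z s))\<^sup>2"
        unfolding w'_def using * s by (intro C zR inR) auto
      also have "\<dots> \<le> C * (E * norm (z1 0 - z 0))\<^sup>2"
        using * s E(1) z C(1)
        by (intro mult_left_mono power_mono space) (auto intro: sol_subset)
      finally show "norm (lagrangian (z1 s) - lagrangian (z s) - w' s) \<le> C * (E * norm (z1 0 - z 0))\<^sup>2"
        by simp
    qed simp
    also have "\<dots> = C * E\<^sup>2 * \<tau> * (norm (z1 0 - z 0))\<^sup>2"
      using * by (simp add: power_mult_distrib algebra_simps)
    also have "\<dots> \<le> C * E\<^sup>2 * T * (norm (z1 0 - z 0))\<^sup>2"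
      using * C(1) by (intro mult_right_mono mult_left_mono) auto
    also have "\<dots> \<le> K * (norm (z1 0 - z 0))\<^sup>2" using K by (intro mult_right_mono) auto
    finally show "\<bar>act z1 \<tau> - act z \<tau> - (lam (z \<tau>) (z1 \<tau> - z \<tau>) - lam (z 0) (z1 0 - z 0))\<bar>
        \<le> K * (norm (z1 0 - z 0))\<^sup>2"
      by (simp add: w_def)
  qed
qed

lemma sol_unique:
  assumes "sol T z" "sol T z1" "z1 0 = z 0" "s \<in> {0..T}"
  shows "z1 s = z s"
proof -
  have "0 \<le> T" using assms by auto
  obtain \<delta> K where "\<delta> > 0" "K \<ge> 0"
    "\<And>\<tau> \<tau>' z1 z2. sol \<tau> z1 \<Longrightarrow> sol \<tau>' z2 \<Longrightarrow> \<tau> \<in> {0..T} \<Longrightarrow> \<tau>' \<in> {0..T} \<Longrightarrow>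
      norm (z1 0 - z 0) < \<delta> \<Longrightarrow> norm (z2 0 - z 0) < \<delta> \<Longrightarrow>
      norm (z1 \<tau> - z2 \<tau>') \<le> K * (norm (z1 0 - z2 0) + \<bar>\<tau> - \<tau>'\<bar>)"
    using trajectory_tube[OF assms(1) \<open>0 \<le> T\<close>] by metis
  from this(1) this(3)[of s z1 s z] show ?thesis
    using assms by (auto intro: sol_subset)
qed

end

section \<open>Preimages under a perturbed map\<close>

text \<open>
  A quantitative stability of the equation \<open>f v = f w\<close> under perturbations \<open>h\<close> of \<open>f\<close> that are
  merely continuous: solutions of \<open>h v = f w\<close> are the fixed points of \<open>v \<mapsto> f\<^sup>-\<^sup>1 (f v - h v + f w)\<close>, a
  self-map of the ball when \<open>h\<close> is close to \<open>f\<close>, because differentiability of \<open>f\<^sup>-\<^sup>1\<close> at \<open>f w\<close> bounds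
  \<open>|f\<^sup>-\<^sup>1 y - w|\<close> by a multiple of \<open>|y - f w|\<close>.
\<close>
lemma perturbed_preimage:
  fixes f :: "'a::euclidean_space \<Rightarrow> 'b::euclidean_space"
  assumes "open U" "inj_on f U" "continuous_on U f" "open (f ` U)"
    and G: "inv_into U f differentiable_on f ` U" and "w \<in> U" and "\<epsilon> > 0"
  obtains C \<kappa>0 where "C > 0" "\<kappa>0 > 0"
    "\<And>h \<kappa>. continuous_on (cball w \<epsilon>) h \<Longrightarrow> cball w \<epsilon> \<subseteq> U \<Longrightarrow> \<kappa> < \<kappa>0 \<Longrightarrow>
       (\<And>v. v \<in> cball w \<epsilon> \<Longrightarrow> norm (h v - f v) \<le> \<kappa>) \<Longrightarrow>
       \<exists>v\<in>cball w \<epsilon>. h v = f w \<and> norm (v - w) \<le> C * \<kappa>"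
proof -
  let ?G = "inv_into U f" and ?\<eta> = "f w"
  have \<eta>: "?\<eta> \<in> f ` U" using \<open>w \<in> U\<close> by blast
  have "?G differentiable (at ?\<eta>)"
    using G \<eta> \<open>open (f ` U)\<close> by (metis at_within_open differentiable_on_def)
  then obtain D where D: "(?G has_derivative D) (at ?\<eta>)" unfolding differentiable_def by blast
  have lin: "bounded_linear D" using D by (rule has_derivative_bounded_linear)
  define C where "C = onorm D + 1"
  have "C > 0" using onorm_pos_le[OF lin] by (simp add: C_def)
  obtain d where d: "d > 0" "\<And>y. norm (y - ?\<eta>) < d \<Longrightarrow>
      norm (?G y - ?G ?\<eta> - D (y - ?\<eta>)) \<le> 1 * norm (y - ?\<eta>)"
    using D unfolding has_derivative_at_alt by (metis zero_less_one)
  obtain d' where d': "d' > 0" "ball ?\<eta> d' \<subseteq> f ` U"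
    using \<open>open (f ` U)\<close> \<eta> open_contains_ball by metis
  have Gw: "?G ?\<eta> = w" using assms by (simp add: inv_into_f_f)
  have lip: "norm (?G y - w) \<le> C * norm (y - ?\<eta>)" if "norm (y - ?\<eta>) < d" for y
  proof -
    have "norm (?G y - w) \<le> norm (?G y - ?G ?\<eta> - D (y - ?\<eta>)) + norm (D (y - ?\<eta>))"
      using norm_triangle_ineq[of "?G y - ?G ?\<eta> - D (y - ?\<eta>)" "D (y - ?\<eta>)"] by (simp add: Gw)
    also have "\<dots> \<le> C * norm (y - ?\<eta>)"
      using d(2)[OF that] onorm[OF lin, of "y - ?\<eta>"] by (simp add: C_def algebra_simps)
    finally show ?thesis .
  qed
  define \<kappa>0 where "\<kappa>0 = min (min d d') (\<epsilon> / C)"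
  show thesis
  proof (rule that[OF \<open>C > 0\<close>])
    show "\<kappa>0 > 0" using d d' \<open>C > 0\<close> \<open>\<epsilon> > 0\<close> by (simp add: \<kappa>0_def)
    fix h \<kappa>
    assume h: "continuous_on (cball w \<epsilon>) h" "cball w \<epsilon> \<subseteq> U" "\<kappa> < \<kappa>0"
      "\<And>v. v \<in> cball w \<epsilon> \<Longrightarrow> norm (h v - f v) \<le> \<kappa>"
    define \<Phi> where "\<Phi> = (\<lambda>v. ?G (f v - h v + ?\<eta>))"
    have near: "norm ((f v - h v + ?\<eta>) - ?\<eta>) \<le> \<kappa>" if "v \<in> cball w \<epsilon>" for v
      using h(4)[OF that] by (simp add: norm_minus_commute)
    have "\<kappa> < d" "\<kappa> < d'" "\<kappa> < \<epsilon> / C" using h(3) by (auto simp: \<kappa>0_def)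
    have \<Phi>: "norm (\<Phi> v - w) \<le> C * \<kappa>" if "v \<in> cball w \<epsilon>" for v
    proof -
      have "norm (\<Phi> v - w) \<le> C * norm ((f v - h v + ?\<eta>) - ?\<eta>)"
        unfolding \<Phi>_def using near[OF that] \<open>\<kappa> < d\<close> by (intro lip) auto
      also have "\<dots> \<le> C * \<kappa>" using near[OF that] \<open>C > 0\<close> by (intro mult_left_mono) auto
      finally show ?thesis .
    qed
    have mem: "f v - h v + ?\<eta> \<in> f ` U" if "v \<in> cball w \<epsilon>" for v
      using near[OF that] \<open>\<kappa> < d'\<close> d'(2)
      by (intro subsetD[OF d'(2)]) (simp add: dist_norm norm_minus_commute)
    have "continuous_on (cball w \<epsilon>) \<Phi>" unfolding \<Phi>_def
      using h mem assms
      by (intro continuous_on_compose2[OF differentiable_imp_continuous_on[OF G]]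
          continuous_intros continuous_on_subset[OF \<open>continuous_on U f\<close>]) auto
    moreover have "\<Phi> \<in> cball w \<epsilon> \<rightarrow> cball w \<epsilon>"
    proof
      fix v assume "v \<in> cball w \<epsilon>"
      then have "norm (\<Phi> v - w) \<le> C * \<kappa>" by (rule \<Phi>)
      also have "\<dots> \<le> \<epsilon>" using \<open>\<kappa> < \<epsilon> / C\<close> \<open>C > 0\<close> by (simp add: field_simps)
      finally show "\<Phi> v \<in> cball w \<epsilon>" by (simp add: dist_norm norm_minus_commute)
    qed
    ultimately obtain v where v: "v \<in> cball w \<epsilon>" "\<Phi> v = v"
      using brouwer_ball[OF \<open>\<epsilon> > 0\<close>] by metis
    have "f v = f v - h v + ?\<eta>"
      using f_inv_into_f[OF mem[OF v(1)]] v(2) by (simp add: \<Phi>_def)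
    then have "h v = f w" by simp
    then show "\<exists>v\<in>cball w \<epsilon>. h v = f w \<and> norm (v - w) \<le> C * \<kappa>"
      using v \<Phi>[OF v(1)] by auto
  qed
qed

section \<open>The Hamiltonian system of the metric\<close>

text \<open>
  The form \<open>p dx + q dy\<close>, taken as a bilinear form on phase space: the base point enters
  through its momenta only, the tangent vector through its configuration components only.
\<close>
definition liouville :: "(real^'d) \<times> (real^'d) \<times> (real^'d) \<times> (real^'d) \<Rightarrow> (real^'d) \<times> (real^'d) \<times> (real^'d) \<times> (real^'d) \<Rightarrow> real" where
  "liouville = (\<lambda>(x, y, q, p) (x', y', q', p'). p \<bullet> x' + q \<bullet> y')"

definition phase_generators :: "(real^'d \<Rightarrow> real^'d^'d) \<Rightarrow> ('d phase \<Rightarrow> real) set" where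
  "phase_generators g = range (\<lambda>b z. z \<bullet> b) \<union>
     {\<lambda>z. iterated_deriv vs g (fst z) $ i $ j |vs i j. set vs \<subseteq> Basis}"

abbreviation phase_algebra :: "(real^'d \<Rightarrow> real^'d^'d) \<Rightarrow> ('d phase \<Rightarrow> real) set" where
  "phase_algebra g \<equiv> smooth_algebra (phase_generators g)"

lemma liouville_eq_inner:
  "liouville = (\<lambda>a b. (snd (snd (snd a)), fst (snd (snd a))) \<bullet> (fst b, fst (snd b)))"
  by (simp add: liouville_def split_beta fun_eq_iff)

lemma bounded_bilinear_liouville: "bounded_bilinear liouville"
  unfolding liouville_eq_inner
  by (intro bounded_bilinear.comp[OF bounded_bilinear_inner] bounded_linear_Pair
      bounded_linear_fst bounded_linear_snd bounded_linear_compose[OF bounded_linear_fst]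
      bounded_linear_compose[OF bounded_linear_snd])

lemma coordinates_in_phase_algebra:
  "(\<lambda>z. fst z $ i) \<in> phase_algebra g" "(\<lambda>z. fst (snd z) $ i) \<in> phase_algebra g"
  "(\<lambda>z. fst (snd (snd z)) $ i) \<in> phase_algebra g" "(\<lambda>z. snd (snd (snd z)) $ i) \<in> phase_algebra g"
proof -
  have c: "(\<lambda>z. z \<bullet> b) \<in> phase_algebra g" for b
    by (intro smooth_algebra.generator) (auto simp: phase_generators_def)
  show "(\<lambda>z. fst z $ i) \<in> phase_algebra g"
    using c[of "(axis i 1, 0, 0, 0)"] by (simp add: inner_prod_def inner_axis)
  show "(\<lambda>z. fst (snd z) $ i) \<in> phase_algebra g"
    using c[of "(0, axis i 1, 0, 0)"] by (simp add: inner_prod_def inner_axis)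
  show "(\<lambda>z. fst (snd (snd z)) $ i) \<in> phase_algebra g"
    using c[of "(0, 0, axis i 1, 0)"] by (simp add: inner_prod_def inner_axis)
  show "(\<lambda>z. snd (snd (snd z)) $ i) \<in> phase_algebra g"
    using c[of "(0, 0, 0, axis i 1)"] by (simp add: inner_prod_def inner_axis)
qed

text \<open>
  A directional derivative of an iterated partial derivative of \<open>g\<close> is a combination, with constant
  coefficients, of generators that have one more index.
\<close>
lemma phase_algebra_partials:
  fixes g :: "real^'d \<Rightarrow> real^'d^'d"
  assumes g: "smooth_on UNIV g" and f: "f \<in> phase_algebra g"
  shows "partials_in (phase_algebra g) f"
proof (rule smooth_algebra_partials[OF _ f])
  fix f :: "'d phase \<Rightarrow> real" assume "f \<in> phase_generators g"
  then consider b where "f = (\<lambda>z. z \<bullet> b)"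
    | vs i j where "set vs \<subseteq> Basis" "f = (\<lambda>z. iterated_deriv vs g (fst z) $ i $ j)"
    unfolding phase_generators_def by blast
  then show "partials_in (phase_algebra g) f"
  proof cases
    case 1
    then show ?thesis unfolding partials_in_def
      by (intro exI[of _ "\<lambda>h z. h \<bullet> b"])
         (auto intro!: derivative_eq_intros smooth_algebra.const)
  next
    case 2
    let ?d = "\<lambda>x. frechet_derivative (iterated_deriv vs g) (at x)"
    have d: "(iterated_deriv vs g has_derivative ?d x) (at x)" for x
      using g 2(1) unfolding smooth_on_def differentiable_on_def
      by (simp add: frechet_derivative_works)
    show ?thesis unfolding partials_in_def
    proof (intro exI[of _ "\<lambda>h z. ?d (fst z) (fst h) $ i $ j"] conjI allI)
      fix z :: "'d phase"
      have "((\<lambda>z. iterated_deriv vs g (fst z)) has_derivative (\<lambda>h. ?d (fst z) (fst h))) (at z)"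
        by (rule has_derivative_compose[OF has_derivative_fst[OF has_derivative_ident] d])
      then show "(f has_derivative (\<lambda>h. ?d (fst z) (fst h) $ i $ j)) (at z)"
        unfolding 2(2)
        by (intro bounded_linear.has_derivative[OF bounded_linear_vec_nth])
    next
      fix h :: "'d phase"
      have "?d x v $ i $ j = (\<Sum>b\<in>Basis. (v \<bullet> b) * iterated_deriv (b # vs) g x $ i $ j)" for x v
      proof -
        have lin: "linear (?d x)" using d by (rule has_derivative_linear)
        have "?d x v = ?d x (\<Sum>b\<in>Basis. (v \<bullet> b) *\<^sub>R b)" by (simp add: euclidean_representation)
        also have "\<dots> = (\<Sum>b\<in>Basis. (v \<bullet> b) *\<^sub>R ?d x b)"
          using lin by (simp add: linear_sum linear_cmul)
        finally show ?thesis by (simp add: sum_component)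
      qed
      moreover have "(\<lambda>z. \<Sum>b\<in>Basis. (fst h \<bullet> b) * iterated_deriv (b # vs) g (fst z) $ i $ j)
          \<in> phase_algebra g"
      proof (intro smooth_algebra_sum smooth_algebra.mult smooth_algebra.const)
        fix b :: "real^'d" assume "b \<in> Basis"
        then have "set (b # vs) \<subseteq> Basis" using 2(1) by simp
        then show "(\<lambda>z. iterated_deriv (b # vs) g (fst z) $ i $ j) \<in> phase_algebra g"
          unfolding phase_generators_def by (intro smooth_algebra.generator UnI2) blast
      qed
      ultimately show "(\<lambda>z. ?d (fst z) (fst h) $ i $ j) \<in> phase_algebra g" by (simp only:)
    qed
  qed
qed

lemma metric_in_phase_algebra:
  fixes g :: "real^'d \<Rightarrow> real^'d^'d"
  assumes "metric_coefficients g"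
  shows "(\<lambda>z. g (fst z) $ i $ j) \<in> phase_algebra g"
    and "(\<lambda>z. matrix_inv (g (fst z)) $ i $ j) \<in> phase_algebra g"
proof -
  have gen: "(\<lambda>z. g (fst z) $ i $ j) \<in> phase_algebra g" for i j
    unfolding phase_generators_def
    by (intro smooth_algebra.generator UnI2 CollectI exI[of _ "[]"] exI[of _ i] exI[of _ j]) simp
  then show "(\<lambda>z. g (fst z) $ i $ j) \<in> phase_algebra g" .
  have "invertible (g x)" for x
  proof -
    have "v = 0" if "g x *v v = 0" for v
      using assms that unfolding metric_coefficients_def by (metis inner_zero_left less_irrefl)
    then show ?thesis
      using matrix_left_invertible_ker invertible_left_inverse by blast
  qed
  then show "(\<lambda>z. matrix_inv (g (fst z)) $ i $ j) \<in> phase_algebra g"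
    by (intro smooth_algebra_matrix_inv gen)
qed

text \<open>
  The only term that is not polynomial in the coordinates and the entries of \<open>g\<close> and its inverse is
  the derivative in \<open>x\<close> of the kinetic form \<open>(G(x) y, y)\<close>. It is a directional derivative, along the
  \<open>x\<close>-axes of phase space, of a member of the algebra.
\<close>
lemma hamiltonian_in_phase_algebra:
  fixes g :: "real^'d \<Rightarrow> real^'d^'d"
  assumes g: "metric_coefficients g"
  shows "(\<lambda>(x, y, q, p). hamiltonian g x y q p) \<in> phase_algebra g"
proof -
  have smooth: "smooth_on UNIV g" using g by (simp add: metric_coefficients_def)
  note in_alg = smooth_algebra.const smooth_algebra.add smooth_algebra.mult smooth_algebra_minus
    smooth_algebra_sum coordinates_in_phase_algebra metric_in_phase_algebra[OF g]
  let ?\<phi> = "\<lambda>z :: 'd phase. (matrix_inv (g (fst z)) *v fst (snd z)) \<bullet> fst (snd z)"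
  have "?\<phi> \<in> phase_algebra g"
    unfolding inner_vec_def matrix_vector_mult_def by (simp, intro in_alg)
  then obtain D where D: "\<And>z. (?\<phi> has_derivative (\<lambda>h. D h z)) (at z)" "\<And>h. D h \<in> phase_algebra g"
    using phase_algebra_partials[OF smooth] unfolding partials_in_def by blast
  have grad: "gradient (\<lambda>x'. (matrix_inv (g x') *v fst (snd z)) \<bullet> fst (snd z)) (fst z) $ i
      = D (axis i 1, 0, 0, 0) z" for z i
  proof -
    have "((\<lambda>x'. ?\<phi> (x', snd z)) has_derivative (\<lambda>h. D (h, 0) z)) (at (fst z))"
      by (rule has_derivative_compose[of "\<lambda>x'. (x', snd z)" "\<lambda>h. (h, 0)" _ _ ?\<phi>])
         (use D(1)[of z] in \<open>auto intro!: derivative_eq_intros\<close>)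
    from has_derivative_imp_gradient[OF this, of "axis i 1"] show ?thesis
      by (simp add: inner_axis zero_prod_def)
  qed
  have "(\<lambda>(x, y, q, p). hamiltonian g x y q p) = (\<lambda>z.
      1/2 * (\<Sum>i\<in>UNIV. (\<Sum>j\<in>UNIV. g (fst z) $ i $ j * fst (snd (snd z)) $ j) * fst (snd (snd z)) $ i)
      + - (\<Sum>i\<in>UNIV. (\<Sum>j\<in>UNIV. matrix_inv (g (fst z)) $ i $ j * fst (snd z) $ j) * snd (snd (snd z)) $ i)
      + 1/2 * (\<Sum>i\<in>UNIV. D (axis i 1, 0, 0, 0) z * fst (snd (snd z)) $ i))"
    by (auto simp: fun_eq_iff hamiltonian_def grad[symmetric] inner_vec_def matrix_vector_mult_def)
  also have "\<dots> \<in> phase_algebra g" by (intro in_alg D(2))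
  finally show ?thesis .
qed

lemma exact_hamiltonian_system_phase:
  fixes g :: "real^'d \<Rightarrow> real^'d^'d"
  assumes g: "metric_coefficients g"
  shows "exact_hamiltonian_system liouville (\<lambda>(x, y, q, p). hamiltonian g x y q p) (hamiltonian_field g)"
proof -
  let ?H = "\<lambda>(x, y, q, p). hamiltonian g x y q p"
  have smooth: "smooth_on UNIV g" using g by (simp add: metric_coefficients_def)
  note partials = phase_algebra_partials[OF smooth]
  obtain D where D: "\<And>z. (?H has_derivative (\<lambda>h. D h z)) (at z)" "\<And>h. D h \<in> phase_algebra g"
    using partials[OF hamiltonian_in_phase_algebra[OF g]] unfolding partials_in_def by blast
  \<comment> \<open>Partial gradients are directional derivatives of \<open>?H\<close> along coordinate subspaces.\<close>
  have along: "((\<lambda>u. ?H (e u)) has_derivative (\<lambda>h. D (e' h) (e u))) (at u)"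
    if "(e has_derivative e') (at u)" for e :: "real^'d \<Rightarrow> 'd phase" and e' u
    by (rule has_derivative_compose[OF that D(1)])
  have gx: "gradient (\<lambda>x'. hamiltonian g x' y q p) x \<bullet> h = D (h, 0, 0, 0) (x, y, q, p)" for x y q p h
    by (rule has_derivative_imp_gradient, rule along[of "\<lambda>x'. (x', y, q, p)" "\<lambda>h. (h, 0, 0, 0)", simplified])
       (intro has_derivative_Pair has_derivative_ident has_derivative_const)
  have gy: "gradient (\<lambda>y'. hamiltonian g x y' q p) y \<bullet> h = D (0, h, 0, 0) (x, y, q, p)" for x y q p h
    by (rule has_derivative_imp_gradient, rule along[of "\<lambda>y'. (x, y', q, p)" "\<lambda>h. (0, h, 0, 0)", simplified])
       (intro has_derivative_Pair has_derivative_ident has_derivative_const)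
  have gq: "gradient (\<lambda>q'. hamiltonian g x y q' p) q \<bullet> h = D (0, 0, h, 0) (x, y, q, p)" for x y q p h
    by (rule has_derivative_imp_gradient, rule along[of "\<lambda>q'. (x, y, q', p)" "\<lambda>h. (0, 0, h, 0)", simplified])
       (intro has_derivative_Pair has_derivative_ident has_derivative_const)
  have gp: "gradient (\<lambda>p'. hamiltonian g x y q p') p \<bullet> h = D (0, 0, 0, h) (x, y, q, p)" for x y q p h
    by (rule has_derivative_imp_gradient, rule along[of "\<lambda>p'. (x, y, q, p')" "\<lambda>h. (0, 0, 0, h)", simplified])
       (intro has_derivative_Pair has_derivative_ident has_derivative_const)
  note grad = gx gy gq gp
  have split: "D (hx, hy, hq, hp) z = D (hx, 0, 0, 0) z + D (0, hy, 0, 0) z + D (0, 0, hq, 0) z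
      + D (0, 0, 0, hp) z" for hx hy hq hp z
  proof -
    interpret l: linear "\<lambda>h. D h z" using D(1) by (rule has_derivative_linear)
    show ?thesis by (simp add: l.add[symmetric])
  qed
  show ?thesis
  proof (rule exact_hamiltonian_system.intro)
    show "bounded_bilinear liouville" by (rule bounded_bilinear_liouville)
  next
    fix z :: "'d phase"
    have "D h z = liouville h (hamiltonian_field g z) - liouville (hamiltonian_field g z) h" for h
    proof -
      obtain x y q p hx hy hq hp where zh: "z = (x, y, q, p)" "h = (hx, hy, hq, hp)"
        by (metis prod_cases4)
      show ?thesis unfolding zh
        by (subst split)
           (simp add: liouville_def hamiltonian_field_def grad[symmetric] inner_commute)
    qed
    then show "(?H has_derivative (\<lambda>h. liouville h (hamiltonian_field g z)
        - liouville (hamiltonian_field g z) h)) (at z)"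
      using D(1)[of z] by simp
  next
    fix R :: real
    let ?F = "hamiltonian_field g"
    \<comment> \<open>Each component of the field is a directional derivative of the Hamiltonian.\<close>
    have comp: "(\<lambda>z. ?F z \<bullet> b) \<in> phase_algebra g" for b
    proof -
      obtain bx by' bq bp where b: "b = (bx, by', bq, bp)" by (cases b)
      have "?F z \<bullet> b = D (- bp, - bq, by', bx) z" for z
      proof -
        obtain x y q p where z: "z = (x, y, q, p)" by (metis prod_cases4)
        show ?thesis unfolding z b
          by (subst split) (simp add: hamiltonian_field_def grad[symmetric])
      qed
      then show ?thesis using D(2) by simp
    qed
    have "\<exists>K\<ge>0. \<forall>u\<in>cball 0 R. \<forall>v\<in>cball 0 R. \<bar>?F u \<bullet> b - ?F v \<bullet> b\<bar> \<le> K * norm (u - v)" for b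
      by (rule partials_in_lipschitz_on_ball[OF partials[OF comp] partials])
    then obtain K where K: "\<And>b. K b \<ge> 0" "\<And>b u v. u \<in> cball 0 R \<Longrightarrow> v \<in> cball 0 R \<Longrightarrow>
        \<bar>?F u \<bullet> b - ?F v \<bullet> b\<bar> \<le> K b * norm (u - v)" by metis
    show "\<exists>K\<ge>0. \<forall>u\<in>cball 0 R. \<forall>v\<in>cball 0 R. norm (?F u - ?F v) \<le> K * norm (u - v)"
    proof (intro exI[of _ "\<Sum>b\<in>Basis. K b"] conjI ballI)
      show "0 \<le> (\<Sum>b\<in>Basis. K b)" using K(1) by (simp add: sum_nonneg)
      fix u v :: "'d phase" assume uv: "u \<in> cball 0 R" "v \<in> cball 0 R"
      have "norm (?F u - ?F v) \<le> (\<Sum>b\<in>Basis. \<bar>(?F u - ?F v) \<bullet> b\<bar>)" by (rule norm_le_l1)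
      also have "\<dots> \<le> (\<Sum>b\<in>Basis. K b * norm (u - v))"
        using K(2)[OF uv] by (intro sum_mono) (simp add: inner_diff_left)
      finally show "norm (?F u - ?F v) \<le> (\<Sum>b\<in>Basis. K b) * norm (u - v)"
        by (simp add: sum_distrib_right)
    qed
  qed
qed

section \<open>Flow and action\<close>

locale metric =
  fixes g :: "real^'d \<Rightarrow> real^'d^'d"
  assumes metric: "metric_coefficients g"

sublocale metric \<subseteq>
  exact_hamiltonian_system liouville "\<lambda>(x, y, q, p). hamiltonian g x y q p" "hamiltonian_field g"
  by (rule exact_hamiltonian_system_phase[OF metric])

context metric
begin

lemma flow_eq:
  assumes "is_solution g T z0 z" "s \<in> {0..T}"
  shows "flow g s z0 = z s"
  unfolding flow_def
proof (rule the_equality)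
  have z: "z 0 = z0" "sol s z"
    using assms sol_subset[of T z s] by (auto simp: is_solution_def sol_def)
  then show "\<exists>z'. is_solution g s z0 z' \<and> z' s = z s"
    by (auto simp: is_solution_def sol_def)
  fix w assume "\<exists>z'. is_solution g s z0 z' \<and> z' s = w"
  then obtain z' where "z' 0 = z0" "sol s z'" "z' s = w"
    by (auto simp: is_solution_def sol_def)
  then show "w = z s" using sol_unique[OF z(2)] z(1) assms(2) by auto
qed

lemma sol_flow:
  assumes "solution_exists g T z0" "0 \<le> T"
  shows "sol T (\<lambda>s. flow g s z0)" "flow g 0 z0 = z0"
proof -
  obtain z where z: "is_solution g T z0 z" using assms unfolding solution_exists_def by blast
  have eq: "flow g s z0 = z s" if "s \<in> {0..T}" for s using flow_eq[OF z that] .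
  show "flow g 0 z0 = z0" using eq[of 0] z assms by (simp add: is_solution_def)
  show "sol T (\<lambda>s. flow g s z0)" unfolding sol_def
  proof
    fix s assume s: "s \<in> {0..T}"
    have "(z has_vector_derivative hamiltonian_field g (flow g s z0)) (at s within {0..T})"
      using z s eq[OF s] by (auto simp: is_solution_def)
    then show "((\<lambda>s. flow g s z0) has_vector_derivative hamiltonian_field g (flow g s z0)) (at s within {0..T})"
      by (rule has_vector_derivative_transform[OF s, rotated]) (use eq in auto)
  qed
qed

lemma action_eq_act:
  assumes "solution_exists g T z0" "0 < \<tau>" "\<tau> \<le> T"
  shows "action g \<tau> z0 = act (\<lambda>s. flow g s z0) \<tau>"
  unfolding action_def act_def
proof (rule integral_cong)
  fix s assume s: "s \<in> {0..\<tau>}"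
  let ?z = "\<lambda>s. flow g s z0"
  have "sol \<tau> ?z" using sol_subset[OF sol_flow(1)] assms by auto
  then have d: "(?z has_vector_derivative hamiltonian_field g (?z s)) (at s within {0..\<tau>})"
    using s by (simp add: sol_def)
  have "((\<lambda>s. fst (?z s)) has_vector_derivative fst (hamiltonian_field g (?z s))) (at s within {0..\<tau>})"
    by (rule bounded_linear.has_vector_derivative[OF bounded_linear_fst d])
  then have X: "vector_derivative (\<lambda>s. flow_X g s z0) (at s within {0..\<tau>}) = fst (hamiltonian_field g (?z s))"
    unfolding flow_X_def using assms s by (intro vector_derivative_within_closed_interval) auto
  have "((\<lambda>s. fst (snd (?z s))) has_vector_derivative fst (snd (hamiltonian_field g (?z s)))) (at s within {0..\<tau>})"
    by (intro bounded_linear.has_vector_derivative[OF bounded_linear_fst]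
        bounded_linear.has_vector_derivative[OF bounded_linear_snd] d)
  then have Y: "vector_derivative (\<lambda>s. flow_Y g s z0) (at s within {0..\<tau>}) = fst (snd (hamiltonian_field g (?z s)))"
    unfolding flow_Y_def using assms s by (intro vector_derivative_within_closed_interval) auto
  show "flow_P g s z0 \<bullet> vector_derivative (\<lambda>s'. flow_X g s' z0) (at s within {0..\<tau>})
     + flow_Q g s z0 \<bullet> vector_derivative (\<lambda>s'. flow_Y g s' z0) (at s within {0..\<tau>})
     - hamiltonian g (flow_X g s z0) (flow_Y g s z0) (flow_Q g s z0) (flow_P g s z0) = lagrangian (?z s)"
    unfolding X Y lagrangian_def
    by (simp add: liouville_def split_beta flow_X_def flow_Y_def flow_Q_def flow_P_def)
qed

end

section \<open>The two-point function\<close>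

lemma open_polydisc: "open (polydisc c t)"
  unfolding polydisc_def by (intro open_Times open_ball)

lemma polydisc_antimono:
  assumes "0 \<le> c" "0 < s" "s \<le> t"
  shows "polydisc c t \<subseteq> polydisc c s"
proof -
  have "c\<^sup>2 / t\<^sup>2 \<le> c\<^sup>2 / s\<^sup>2" "c^3 / t^3 \<le> c^3 / s^3"
    using assms by (auto intro!: divide_left_mono power_mono)
  then show ?thesis unfolding polydisc_def by (intro Sigma_mono subset_ball)
qed

lemma norm_phase_le: "norm ((a, b, w) :: 'a::real_normed_vector \<times> 'b::real_normed_vector \<times> 'c::real_normed_vector)
    \<le> norm (a, b) + norm w"
proof -
  have "norm (a, b, w) = norm ((a, b), w)" by (simp add: norm_Pair add.assoc)
  then show ?thesis using norm_Pair_le[of "(a, b)" w] by simp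
qed

lemma norm_configuration_le:
  fixes a :: "'a::real_normed_vector \<times> 'b::real_normed_vector \<times> 'c::real_normed_vector"
  shows "norm (fst a, fst (snd a)) \<le> norm a"
  by (cases a) (simp add: norm_Pair)

locale two_point_problem = metric g for g :: "real^'d \<Rightarrow> real^'d^'d" +
  fixes c t0 :: real
  assumes c_pos: "c > 0"
    and exists_in_polydisc: "\<And>x0 y0 t w. \<lbrakk>0 < t; t \<le> t0; norm y0 \<le> c / t; w \<in> polydisc c t\<rbrakk> \<Longrightarrow>
      solution_exists g t (x0, y0, w)"
    and diffeo: "\<And>x0 y0 t. \<lbrakk>0 < t; t \<le> t0; norm y0 \<le> c / t\<rbrakk> \<Longrightarrow>
      diffeo_onto_image (polydisc c t) (endpoint_map g t x0 y0)"
begin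

lemma initial_momenta_eq:
  assumes "0 < t" "t \<le> t0" "norm y0 \<le> c / t" "w \<in> polydisc c t"
    and "endpoint_map g t x0 y0 w = (x, y)"
  shows "initial_momenta g c t x y x0 y0 = w"
proof -
  have "inj_on (endpoint_map g t x0 y0) (polydisc c t)"
    using diffeo[OF assms(1-3)] by (simp add: diffeo_onto_image_def)
  then show ?thesis unfolding initial_momenta_def
    using assms by (intro the_equality) (metis inj_onD)+
qed

lemma endpoint_map_eq:
  "endpoint_map g t x0 y0 w = (fst (flow g t (x0, y0, w)), fst (snd (flow g t (x0, y0, w))))"
  by (cases w) (simp add: endpoint_map_def flow_X_def flow_Y_def)

lemma two_point_function_eq_act:
  assumes "0 < t" "t \<le> T" "T \<le> t0" "norm y0 \<le> c / T" "w \<in> polydisc c T"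
    and "endpoint_map g t x0 y0 w = (x, y)"
  shows "two_point_function g c t x y x0 y0 = act (\<lambda>s. flow g s (x0, y0, w)) t"
proof -
  have "c / T \<le> c / t" using assms c_pos by (intro divide_left_mono) auto
  moreover have "w \<in> polydisc c t" using polydisc_antimono[of c t T] assms c_pos by auto
  ultimately have "initial_momenta g c t x y x0 y0 = w"
    using assms by (intro initial_momenta_eq) auto
  then show ?thesis
    using action_eq_act[OF exists_in_polydisc] assms
    unfolding two_point_function_def joining_point_def by simp
qed

text \<open>
  The base trajectory \<open>z\<close> joins \<open>(x0, y0)\<close> to \<open>(x, y)\<close> in time \<open>t\<close> and is followed up to \<open>T \<ge> t\<close>, so that final
  times on both sides of \<open>t\<close> are covered. The boundary terms contain only the prescribed
  configurations, because \<open>liouville\<close> ignores the momenta of its second argument; the dummy momenta are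
  set to \<open>0\<close>. The momenta of the perturbed characteristic differ from \<open>w\<close> by \<open>O(\<rho>)\<close>, where \<open>\<rho>\<close> is the
  change of the data, and enter only through the quadratic error of \<open>trajectory_tube\<close>.
\<close>
lemma two_point_function_expansion:
  assumes T: "T \<le> t0" "norm y0 \<le> c / T" and t: "0 < t" "t \<le> T"
    and w: "w \<in> polydisc c T" and xy: "endpoint_map g t x0 y0 w = (x, y)"
  defines "z \<equiv> \<lambda>s. flow g s (x0, y0, w)"
  obtains \<delta> K where "\<delta> > 0"
    "\<And>s x' y' x0' y0'. \<lbrakk>0 < s; s \<le> T; norm y0' \<le> c / s;
        \<bar>s - t\<bar> + norm (x' - x, y' - y) + norm (x0' - x0, y0' - y0) < \<delta>\<rbrakk> \<Longrightarrow>
      \<bar>two_point_function g c s x' y' x0' y0' - act z s - (liouville (z s) ((x', y', 0) - z s)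
          - liouville (x0, y0, w) (x0' - x0, y0' - y0, 0))\<bar>
        \<le> K * (\<bar>s - t\<bar> + norm (x' - x, y' - y) + norm (x0' - x0, y0' - y0))\<^sup>2"
proof -
  have "0 < T" using t by simp
  have ct: "norm y0 \<le> c / t"
    using T(2) t c_pos by (meson divide_left_mono less_le_trans mult_pos_pos less_imp_le order_trans)
  have z: "sol T z" "z 0 = (x0, y0, w)"
    unfolding z_def using sol_flow[OF exists_in_polydisc[OF \<open>0 < T\<close> T w]] \<open>0 < T\<close> by auto
  obtain \<delta>1 K1 where tube: "\<delta>1 > 0" "K1 \<ge> 0"
    "\<And>\<tau> \<tau>' z1 z2. sol \<tau> z1 \<Longrightarrow> sol \<tau>' z2 \<Longrightarrow> \<tau> \<in> {0..T} \<Longrightarrow> \<tau>' \<in> {0..T} \<Longrightarrow>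
      norm (z1 0 - z 0) < \<delta>1 \<Longrightarrow> norm (z2 0 - z 0) < \<delta>1 \<Longrightarrow>
      norm (z1 \<tau> - z2 \<tau>') \<le> K1 * (norm (z1 0 - z2 0) + \<bar>\<tau> - \<tau>'\<bar>)"
    "\<And>\<tau> z1. sol \<tau> z1 \<Longrightarrow> \<tau> \<in> {0..T} \<Longrightarrow> norm (z1 0 - z 0) < \<delta>1 \<Longrightarrow>
      \<bar>act z1 \<tau> - act z \<tau> - (liouville (z \<tau>) (z1 \<tau> - z \<tau>) - liouville (z 0) (z1 0 - z 0))\<bar>
        \<le> K1 * (norm (z1 0 - z 0))\<^sup>2"
    using trajectory_tube[OF z(1)] \<open>0 < T\<close> by (metis less_imp_le)
  obtain \<epsilon>1 where \<epsilon>1: "\<epsilon>1 > 0" "cball w \<epsilon>1 \<subseteq> polydisc c T"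
    using open_polydisc w open_contains_cball by metis
  define \<epsilon> where "\<epsilon> = min \<epsilon>1 (\<delta>1 / 2)"
  have \<epsilon>: "\<epsilon> > 0" "\<epsilon> \<le> \<delta>1 / 2" "cball w \<epsilon> \<subseteq> polydisc c T"
    using \<epsilon>1 tube(1) by (auto simp: \<epsilon>_def)
  have inT: "v \<in> polydisc c s" if "v \<in> cball w \<epsilon>" "0 < s" "s \<le> T" for v s
    using that \<epsilon>(3) polydisc_antimono[of c s T] c_pos by auto
  have flows: "sol s (\<lambda>s. flow g s (x0', y0', v))" "flow g 0 (x0', y0', v) = (x0', y0', v)"
    if "v \<in> cball w \<epsilon>" "0 < s" "s \<le> T" "norm y0' \<le> c / s" for v s x0' y0'
    using sol_flow[OF exists_in_polydisc[OF _ _ _ inT]] that T by auto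
  let ?f = "endpoint_map g t x0 y0"
  have "diffeo_onto_image (polydisc c t) ?f" using t T ct by (intro diffeo) auto
  then have f: "inj_on ?f (polydisc c t)" "smooth_on (polydisc c t) ?f"
    "smooth_on (?f ` polydisc c t) (inv_into (polydisc c t) ?f)"
    by (auto simp: diffeo_onto_image_def)
  have "continuous_on (polydisc c t) ?f"
    using f(2) unfolding smooth_on_def
    by (auto dest!: spec[of _ "[]"] intro: differentiable_imp_continuous_on)
  moreover have "open (?f ` polydisc c t)"
    "inv_into (polydisc c t) ?f differentiable_on ?f ` polydisc c t"
    using f(3) unfolding smooth_on_def by (auto dest!: spec[of _ "[]"])
  moreover have "w \<in> polydisc c t" using inT[of w t] t \<epsilon>(1) by simp
  ultimately obtain C \<kappa>0 where pre: "C > 0" "\<kappa>0 > 0"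
    "\<And>h \<kappa>. continuous_on (cball w \<epsilon>) h \<Longrightarrow> cball w \<epsilon> \<subseteq> polydisc c t \<Longrightarrow> \<kappa> < \<kappa>0 \<Longrightarrow>
       (\<And>v. v \<in> cball w \<epsilon> \<Longrightarrow> norm (h v - ?f v) \<le> \<kappa>) \<Longrightarrow>
       \<exists>v\<in>cball w \<epsilon>. h v = ?f w \<and> norm (v - w) \<le> C * \<kappa>"
    using perturbed_preimage[OF open_polydisc f(1) _ _ _ _ \<epsilon>(1)] by metis
  define \<delta> where "\<delta> = min (\<delta>1 / 2) (\<kappa>0 / (K1 + 1))"
  have "\<delta> \<le> \<kappa>0 / (K1 + 1)" by (simp add: \<delta>_def)
  then have "(K1 + 1) * \<delta> \<le> \<kappa>0" using tube(2) by (simp add: pos_le_divide_eq mult.commute)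
  moreover have "\<delta> > 0" using tube(1,2) pre(2) by (auto simp: \<delta>_def)
  moreover have "\<delta> \<le> \<delta>1 / 2" unfolding \<delta>_def by (rule min.cobounded1)
  ultimately have \<delta>: "\<delta> > 0" "\<delta> \<le> \<delta>1 / 2" "(K1 + 1) * \<delta> \<le> \<kappa>0" by auto
  show thesis
  proof (rule that[OF \<delta>(1)])
    fix s x' y' x0' y0'
    define \<rho> where "\<rho> = \<bar>s - t\<bar> + norm (x' - x, y' - y) + norm (x0' - x0, y0' - y0)"
    assume s: "0 < s" "s \<le> T" "norm y0' \<le> c / s"
      and "\<bar>s - t\<bar> + norm (x' - x, y' - y) + norm (x0' - x0, y0' - y0) < \<delta>"
    then have \<rho>: "0 \<le> \<rho>" "\<rho> < \<delta>" "norm (x0' - x0, y0' - y0) \<le> \<rho>" by (auto simp: \<rho>_def)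
    \<comment> \<open>The change of the target is moved into the map, so that \<open>h v = ?f w\<close> is the perturbed problem.\<close>
    define h where "h = (\<lambda>v. endpoint_map g s x0' y0' v - (x' - x, y' - y))"
    let ?z = "\<lambda>v \<tau>. flow g \<tau> (x0', y0', v)"
    have start: "norm (?z v 0 - z 0) \<le> \<rho> + norm (v - w)" if "v \<in> cball w \<epsilon>" for v
      using norm_phase_le[of "x0' - x0" "y0' - y0" "v - w"] \<rho>(3) flows(2)[OF that s]
      by (simp add: z(2))
    have close: "norm (?z v 0 - z 0) < \<delta>1" if "v \<in> cball w \<epsilon>" for v
      using start[OF that] that \<rho>(2) \<delta>(2) \<epsilon>(2) by (auto simp: dist_norm norm_minus_commute)
    have near: "norm (h v - ?f v) \<le> (K1 + 1) * \<rho>" if v: "v \<in> cball w \<epsilon>" for v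
    proof -
      let ?z' = "\<lambda>\<tau>. flow g \<tau> (x0, y0, v)"
      have z': "sol t ?z'" "?z' 0 = (x0, y0, v)" using flows[OF v t ct] by auto
      have "norm (?z' 0 - z 0) < \<delta>1"
        using v \<epsilon>(2) tube(1) norm_phase_le[of 0 0 "v - w"]
        by (auto simp: z' z(2) dist_norm norm_minus_commute)
      then have "norm (?z v s - ?z' t) \<le> K1 * (norm (?z v 0 - ?z' 0) + \<bar>s - t\<bar>)"
        using flows(1)[OF v s] z'(1) s t close[OF v] by (intro tube(3)) auto
      also have "?z v 0 - ?z' 0 = (x0' - x0, y0' - y0, 0)" using flows(2)[OF v s] z'(2) by simp
      also have "K1 * (norm (x0' - x0, y0' - y0, 0 :: (real^'d) \<times> (real^'d)) + \<bar>s - t\<bar>)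
          \<le> K1 * (\<rho> - norm (x' - x, y' - y))"
        using norm_phase_le[of "x0' - x0" "y0' - y0" "0 :: (real^'d) \<times> (real^'d)"] tube(2)
        by (intro mult_left_mono) (auto simp: \<rho>_def)
      finally have 1: "norm (?z v s - ?z' t) \<le> K1 * (\<rho> - norm (x' - x, y' - y))" .
      have "h v - ?f v = (fst (?z v s - ?z' t), fst (snd (?z v s - ?z' t))) - (x' - x, y' - y)"
        by (simp add: h_def endpoint_map_eq)
      then have "norm (h v - ?f v) \<le> norm (?z v s - ?z' t) + norm (x' - x, y' - y)"
        using norm_triangle_ineq4[of "(fst (?z v s - ?z' t), fst (snd (?z v s - ?z' t)))" "(x' - x, y' - y)"]
          norm_configuration_le[of "?z v s - ?z' t"] by simp
      also have "\<dots> \<le> K1 * \<rho> + norm (x' - x, y' - y)"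
        using 1 tube(2) mult_left_mono[of "\<rho> - norm (x' - x, y' - y)" \<rho> K1] by simp
      also have "\<dots> \<le> (K1 + 1) * \<rho>" by (simp add: \<rho>_def algebra_simps)
      finally show ?thesis .
    qed
    have "K1-lipschitz_on (cball w \<epsilon>) h"
    proof (rule lipschitz_onI)
      fix u v assume uv: "u \<in> cball w \<epsilon>" "v \<in> cball w \<epsilon>"
      have "norm (?z u s - ?z v s) \<le> K1 * (norm (?z u 0 - ?z v 0) + \<bar>s - s\<bar>)"
        using flows(1)[OF _ s] uv close s by (intro tube(3)) auto
      also have "\<dots> \<le> K1 * norm (u - v)"
        using flows(2)[OF uv(1) s] flows(2)[OF uv(2) s] norm_phase_le[of 0 0 "u - v"] tube(2)
        by (intro mult_left_mono) auto
      finally show "dist (h u) (h v) \<le> K1 * dist u v"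
        using norm_configuration_le[of "?z u s - ?z v s"]
        by (simp add: h_def endpoint_map_eq dist_norm)
    qed (rule tube(2))
    then have "continuous_on (cball w \<epsilon>) h" by (rule lipschitz_on_continuous_on)
    moreover have "cball w \<epsilon> \<subseteq> polydisc c t" using inT t by blast
    moreover have "(K1 + 1) * \<rho> < \<kappa>0"
      using \<rho>(2) \<delta>(3) tube(2) mult_strict_left_mono[of \<rho> \<delta> "K1 + 1"] by linarith
    ultimately obtain w' where w': "w' \<in> cball w \<epsilon>" "h w' = ?f w" "norm (w' - w) \<le> C * ((K1 + 1) * \<rho>)"
      using pre(3)[of h "(K1 + 1) * \<rho>"] near by blast
    have end': "endpoint_map g s x0' y0' w' = (x', y')"
      using w'(2) unfolding h_def xy by (simp add: algebra_simps)
    have S: "two_point_function g c s x' y' x0' y0' = act (?z w') s"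
      using s T inT[OF w'(1)] end' by (intro two_point_function_eq_act) auto
    have "liouville (z s) (?z w' s - z s) = liouville (z s) ((x', y', 0) - z s)"
      using end' by (simp add: endpoint_map_eq liouville_def split_beta)
    moreover have "liouville (z 0) (?z w' 0 - z 0) = liouville (x0, y0, w) (x0' - x0, y0' - y0, 0)"
      using flows(2)[OF w'(1) s] by (simp add: z(2) liouville_def split_beta)
    ultimately have "\<bar>act (?z w') s - act z s - (liouville (z s) ((x', y', 0) - z s)
        - liouville (x0, y0, w) (x0' - x0, y0' - y0, 0))\<bar> \<le> K1 * (norm (?z w' 0 - z 0))\<^sup>2"
      using tube(4)[of s "?z w'"] flows(1)[OF w'(1) s] close[OF w'(1)] s by simp
    also have "\<dots> \<le> K1 * ((1 + C * (K1 + 1)) * \<rho>)\<^sup>2"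
      using start[OF w'(1)] w'(3) tube(2)
      by (intro mult_left_mono power_mono) (auto simp: algebra_simps)
    finally show "\<bar>two_point_function g c s x' y' x0' y0' - act z s - (liouville (z s) ((x', y', 0) - z s)
          - liouville (x0, y0, w) (x0' - x0, y0' - y0, 0))\<bar>
        \<le> (K1 * (1 + C * (K1 + 1))\<^sup>2) * (\<bar>s - t\<bar> + norm (x' - x, y' - y) + norm (x0' - x0, y0' - y0))\<^sup>2"
      unfolding S \<rho>_def by (simp add: power_mult_distrib mult.assoc)
  qed
qed

text \<open>
  The comparison function \<open>B\<close> follows the fixed characteristic \<open>z\<close> and corrects for its missing the
  endpoint at times \<open>s \<noteq> t\<close>. It agrees with the two-point function up to \<open>O((s - t)\<^sup>2)\<close>. The correction
  vanishes at \<open>t\<close>, so that its derivative there is \<open>- liouville z (F z)\<close>, which leaves \<open>- H\<close>.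
\<close>
lemma two_point_function_time_derivative:
  assumes t: "0 < t" "t \<le> t0" "norm y0 \<le> c / t"
    and w: "w \<in> polydisc c t" and xy: "endpoint_map g t x0 y0 w = (x, y)"
  shows "((\<lambda>s. two_point_function g c s x y x0 y0) has_real_derivative
      - hamiltonian g x y (flow_Q g t (x0, y0, w)) (flow_P g t (x0, y0, w)))
      (at t within {s. 0 < s \<and> s \<le> t0 \<and> norm y0 \<le> c / s})"
proof -
  define A where "A = {s. 0 < s \<and> s \<le> t0 \<and> norm y0 \<le> c / s}"
  define S where "S = (\<lambda>s. two_point_function g c s x y x0 y0)"
  have "t \<in> A" using t by (simp add: A_def)
  have "((\<lambda>s. c\<^sup>2 / s\<^sup>2) \<longlongrightarrow> c\<^sup>2 / t\<^sup>2) (at t within A)" "((\<lambda>s. c^3 / s^3) \<longlongrightarrow> c^3 / t^3) (at t within A)"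
    using t(1) by (auto intro!: tendsto_intros)
  then have ev: "\<forall>\<^sub>F s in at t within A. w \<in> polydisc c s"
    using w unfolding polydisc_def mem_Times_iff
    by (auto simp: dist_norm elim!: order_tendstoD(1) intro!: eventually_conj)
  \<comment> \<open>If later times are admissible, choose such a \<open>T\<close> with \<open>w\<close> still in its polydisc, which gives
    existence of the base trajectory beyond \<open>t\<close>; otherwise the derivative is one-sided and \<open>T = t\<close>.\<close>
  have "\<exists>T. t \<le> T \<and> T \<in> A \<and> w \<in> polydisc c T \<and> at t within A = at t within (A \<inter> {0..T})"
  proof (cases "\<exists>s\<in>A. t < s")
    case True
    then obtain s where s: "s \<in> A" "t < s" by blast
    obtain d where d: "d > 0" "\<And>u. u \<in> A \<Longrightarrow> u \<noteq> t \<Longrightarrow> dist u t < d \<Longrightarrow> w \<in> polydisc c u"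
      using ev unfolding eventually_at by blast
    define T where "T = min s (t + d / 2)"
    have T: "t < T" "T \<le> s" "dist T t < d" using s d(1) by (auto simp: T_def dist_real_def)
    have "c / s \<le> c / T" using T t(1) c_pos by (intro divide_left_mono) auto
    then have "T \<in> A" using s T t(1) by (auto simp: A_def)
    moreover have "w \<in> polydisc c T" using d(2)[OF \<open>T \<in> A\<close>] T by auto
    moreover have "at t within A = at t within (A \<inter> {0..T})"
      by (rule at_within_nhd[of t "{..<T}"]) (use T(1) in \<open>auto simp: A_def\<close>)
    ultimately show ?thesis using T(1) by (intro exI[of _ T]) auto
  next
    case False
    then have "A \<inter> {0..t} = A" by (force simp: A_def)
    then show ?thesis using \<open>t \<in> A\<close> w by (intro exI[of _ t]) auto
  qed
  then obtain T where T: "t \<le> T" "T \<in> A" "w \<in> polydisc c T" "at t within A = at t within (A \<inter> {0..T})"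
    by blast
  have T': "T \<le> t0" "norm y0 \<le> c / T" "0 < T" using T(2) by (auto simp: A_def)
  define z where "z = (\<lambda>s. flow g s (x0, y0, w))"
  have solz: "sol T z"
    unfolding z_def using sol_flow[OF exists_in_polydisc[OF T'(3,1,2) T(3)]] T' by simp
  obtain \<delta> K where expansion: "\<delta> > 0"
    "\<And>s x' y' x0' y0'. \<lbrakk>0 < s; s \<le> T; norm y0' \<le> c / s;
        \<bar>s - t\<bar> + norm (x' - x, y' - y) + norm (x0' - x0, y0' - y0) < \<delta>\<rbrakk> \<Longrightarrow>
      \<bar>two_point_function g c s x' y' x0' y0' - act z s - (liouville (z s) ((x', y', 0) - z s)
          - liouville (x0, y0, w) (x0' - x0, y0' - y0, 0))\<bar>
        \<le> K * (\<bar>s - t\<bar> + norm (x' - x, y' - y) + norm (x0' - x0, y0' - y0))\<^sup>2"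
    unfolding z_def using two_point_function_expansion[OF T'(1,2) t(1) T(1,3) xy] by blast
  define B where "B = (\<lambda>s. act z s + liouville (z s) ((x, y, 0) - z s))"
  interpret lv: bounded_bilinear "liouville :: 'd phase \<Rightarrow> 'd phase \<Rightarrow> real" by (rule bilinear)
  have zt: "fst (z t) = x" "fst (snd (z t)) = y" using xy by (auto simp: endpoint_map_eq z_def)
  have lv0: "liouville a ((x, y, 0) - z t) = 0" for a
    using zt by (simp add: liouville_def split_beta)
  have "liouville a (0, 0, 0) = 0" for a :: "(real^'d) \<times> (real^'d) \<times> (real^'d) \<times> (real^'d)"
    by (simp add: liouville_def split_beta)
  then have err: "\<bar>S s - B s\<bar> \<le> K * (norm (s - t))\<^sup>2" if "s \<in> A \<inter> {0..T}" "norm (s - t) < \<delta>" for s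
    using expansion(2)[of s y0 x y x0] that by (simp add: A_def S_def B_def diff_diff_eq norm_Pair)
  have "S t = B t" using err[of t] \<open>t \<in> A\<close> T(1) t(1) expansion(1) by simp
  have 1: "((\<lambda>s. S s - B s) has_real_derivative 0) (at t within A \<inter> {0..T})"
    unfolding has_field_derivative_def using err \<open>S t = B t\<close>
    by (intro quadratic_error_imp_has_derivative[OF bounded_linear_mult_right expansion(1), where K = K]) auto
  have tT: "t \<in> {0..T}" using t T by simp
  have dz: "(z has_vector_derivative hamiltonian_field g (z t)) (at t within {0..T})"
    using solz tT by (simp add: sol_def)
  have dlv: "((\<lambda>s. liouville (z s) ((x, y, 0) - z s)) has_vector_derivative
      liouville (z t) (0 - hamiltonian_field g (z t)) + liouville (hamiltonian_field g (z t)) ((x, y, 0) - z t))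
      (at t within {0..T})"
    by (intro lv.has_vector_derivative has_vector_derivative_diff has_vector_derivative_const dz)
  have "(B has_real_derivative lagrangian (z t) - liouville (z t) (hamiltonian_field g (z t)))
      (at t within {0..T})"
    unfolding B_def
    using DERIV_add[OF act_has_derivative[OF solz tT] dlv[folded has_real_derivative_iff_has_vector_derivative]]
    by (simp add: lv0 lv.minus_right)
  then have "(B has_real_derivative - hamiltonian g x y (flow_Q g t (x0, y0, w)) (flow_P g t (x0, y0, w)))
      (at t within A \<inter> {0..T})"
    by (rule DERIV_subset[THEN DERIV_cong])
       (auto simp: lagrangian_def split_beta zt[unfolded z_def] flow_Q_def flow_P_def z_def)
  from DERIV_add[OF 1 this] show ?thesis
    unfolding S_def T(4)[unfolded A_def, symmetric] A_def[symmetric] by (simp add: T(4))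
qed

lemma two_point_function_space_derivatives:
  assumes t: "0 < t" "t \<le> t0" "norm y0 \<le> c / t"
    and w: "(q0, p0) \<in> polydisc c t" and xy: "endpoint_map g t x0 y0 (q0, p0) = (x, y)"
  defines "S \<equiv> two_point_function g c"
  shows "GDERIV (\<lambda>x'. S t x' y x0 y0) x :> flow_P g t (x0, y0, q0, p0)"
    and "GDERIV (\<lambda>y'. S t x y' x0 y0) y :> flow_Q g t (x0, y0, q0, p0)"
    and "GDERIV (\<lambda>x0'. S t x y x0' y0) x0 :> - p0"
    and "((\<lambda>y0'. S t x y x0 y0') has_derivative (\<lambda>h. h \<bullet> - q0)) (at y0 within cball 0 (c / t))"
proof -
  let ?z = "\<lambda>s. flow g s (x0, y0, q0, p0)"
  obtain \<delta> K where expansion: "\<delta> > 0"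
    "\<And>s x' y' x0' y0'. \<lbrakk>0 < s; s \<le> t; norm y0' \<le> c / s;
        \<bar>s - t\<bar> + norm (x' - x, y' - y) + norm (x0' - x0, y0' - y0) < \<delta>\<rbrakk> \<Longrightarrow>
      \<bar>S s x' y' x0' y0' - act ?z s - (liouville (?z s) ((x', y', 0) - ?z s)
          - liouville (x0, y0, q0, p0) (x0' - x0, y0' - y0, 0))\<bar>
        \<le> K * (\<bar>s - t\<bar> + norm (x' - x, y' - y) + norm (x0' - x0, y0' - y0))\<^sup>2"
    unfolding S_def using two_point_function_expansion[OF t(2,3,1) order_refl w xy] by blast
  have S: "S t x y x0 y0 = act ?z t"
    unfolding S_def by (rule two_point_function_eq_act[OF t(1) order_refl t(2,3) w xy])
  have zt: "fst (?z t) = x" "fst (snd (?z t)) = y" using xy by (auto simp: endpoint_map_eq)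
  have err: "\<bar>S t x' y' x0' y0' - S t x y x0 y0 - (flow_P g t (x0, y0, q0, p0) \<bullet> (x' - x)
        + flow_Q g t (x0, y0, q0, p0) \<bullet> (y' - y) - (p0 \<bullet> (x0' - x0) + q0 \<bullet> (y0' - y0)))\<bar>
      \<le> K * (norm (x' - x, y' - y) + norm (x0' - x0, y0' - y0))\<^sup>2"
    if "norm y0' \<le> c / t" "norm (x' - x, y' - y) + norm (x0' - x0, y0' - y0) < \<delta>" for x' y' x0' y0'
    using expansion(2)[of t y0' x' y' x0'] t(1) that zt
    by (simp add: S liouville_def split_beta flow_P_def flow_Q_def)
  show "GDERIV (\<lambda>x'. S t x' y x0 y0) x :> flow_P g t (x0, y0, q0, p0)"
    unfolding gderiv_def using err[of y0 _ y x0] t(3)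
    by (intro quadratic_error_imp_has_derivative[OF bounded_linear_inner_left expansion(1), where K = K])
       (simp add: norm_Pair inner_commute)
  show "GDERIV (\<lambda>y'. S t x y' x0 y0) y :> flow_Q g t (x0, y0, q0, p0)"
    unfolding gderiv_def using err[of y0 x _ x0] t(3)
    by (intro quadratic_error_imp_has_derivative[OF bounded_linear_inner_left expansion(1), where K = K])
       (simp add: norm_Pair inner_commute)
  show "GDERIV (\<lambda>x0'. S t x y x0' y0) x0 :> - p0"
    unfolding gderiv_def using err[of y0 x y] t(3)
    by (intro quadratic_error_imp_has_derivative[OF bounded_linear_inner_left expansion(1), where K = K])
       (simp add: norm_Pair inner_commute)
  show "((\<lambda>y0'. S t x y x0 y0') has_derivative (\<lambda>h. h \<bullet> - q0)) (at y0 within cball 0 (c / t))"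
    using err[of _ x y x0]
    by (intro quadratic_error_imp_has_derivative[OF bounded_linear_inner_left expansion(1), where K = K])
       (simp add: norm_Pair inner_commute)
qed

end

theorem proposition3p3:
  fixes g :: "real^'d \<Rightarrow> real^'d^'d" and c t0 r :: real
  defines "S \<equiv> two_point_function g c"
  assumes "metric_coefficients g"
    and "assumption_E g"
    and "c > 0" and "t0 > 0" and "r > 0"
    and "\<And>x0 y0 t. \<lbrakk>0 < t; t \<le> t0; norm y0 \<le> c / t\<rbrakk> \<Longrightarrow>
           (\<forall>(q0, p0) \<in> polydisc c t. solution_exists g t (x0, y0, q0, p0)) \<and>
           diffeo_onto_image (polydisc c t) (endpoint_map g t x0 y0) \<and>
           reach_domain g r t x0 y0 \<subseteq> endpoint_map g t x0 y0 ` polydisc c t"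
  shows "\<forall>x0 y0 t x y. 0 < t \<and> t \<le> t0 \<and> norm y0 \<le> c / t \<and> (x, y) \<in> reach_domain g r t x0 y0 \<longrightarrow>
      (\<exists>dS_dt.
          ((\<lambda>s. S s x y x0 y0) has_real_derivative dS_dt)
             (at t within {s. 0 < s \<and> s \<le> t0 \<and> norm y0 \<le> c / s}) \<and>
          dS_dt + hamiltonian g x y (gradient (\<lambda>y'. S t x y' x0 y0) y)
                                    (gradient (\<lambda>x'. S t x' y x0 y0) x) = 0) \<and>
      (GDERIV (\<lambda>x'. S t x' y x0 y0) x :> flow_P g t (joining_point g c t x y x0 y0)) \<and>
      (GDERIV (\<lambda>y'. S t x y' x0 y0) y :> flow_Q g t (joining_point g c t x y x0 y0)) \<and>
      (GDERIV (\<lambda>x0'. S t x y x0' y0) x0 :> - snd (initial_momenta g c t x y x0 y0)) \<and>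
      ((\<lambda>y0'. S t x y x0 y0') has_derivative
          (\<lambda>h. h \<bullet> - fst (initial_momenta g c t x y x0 y0))) (at y0 within cball 0 (c / t))"
proof (intro allI impI, elim conjE)
  fix x0 y0 :: "real^'d" and t x y
  assume t: "0 < t" "t \<le> t0" "norm y0 \<le> c / t" and xy: "(x, y) \<in> reach_domain g r t x0 y0"
  interpret two_point_problem g c t0
  proof
    show "metric_coefficients g" "c > 0" by fact+
    fix x0 y0 :: "real^'d" and t assume "0 < t" "t \<le> t0" "norm y0 \<le> c / t"
    note * = assms(7)[OF this, of x0]
    show "diffeo_onto_image (polydisc c t) (endpoint_map g t x0 y0)" using * by blast
    show "solution_exists g t (x0, y0, w)" if "w \<in> polydisc c t" for w using * that by auto
  qed
  obtain q0 p0 where w: "(q0, p0) \<in> polydisc c t" "endpoint_map g t x0 y0 (q0, p0) = (x, y)"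
    using assms(7)[OF t, of x0] xy by (metis (no_types, lifting) imageE subsetD surj_pair)
  note im = initial_momenta_eq[OF t w]
  note space = two_point_function_space_derivatives[OF t w, folded S_def]
  note time = two_point_function_time_derivative[OF t w, folded S_def]
  show "(\<exists>dS_dt.
          ((\<lambda>s. S s x y x0 y0) has_real_derivative dS_dt)
             (at t within {s. 0 < s \<and> s \<le> t0 \<and> norm y0 \<le> c / s}) \<and>
          dS_dt + hamiltonian g x y (gradient (\<lambda>y'. S t x y' x0 y0) y)
                                    (gradient (\<lambda>x'. S t x' y x0 y0) x) = 0) \<and>
      (GDERIV (\<lambda>x'. S t x' y x0 y0) x :> flow_P g t (joining_point g c t x y x0 y0)) \<and>
      (GDERIV (\<lambda>y'. S t x y' x0 y0) y :> flow_Q g t (joining_point g c t x y x0 y0)) \<and>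
      (GDERIV (\<lambda>x0'. S t x y x0' y0) x0 :> - snd (initial_momenta g c t x y x0 y0)) \<and>
      ((\<lambda>y0'. S t x y x0 y0') has_derivative
          (\<lambda>h. h \<bullet> - fst (initial_momenta g c t x y x0 y0))) (at y0 within cball 0 (c / t))"
    unfolding joining_point_def im fst_conv snd_conv gderiv_imp_gradient[OF space(1)]
      gderiv_imp_gradient[OF space(2)]
    by (intro conjI exI[of _ "- hamiltonian g x y (flow_Q g t (x0, y0, q0, p0)) (flow_P g t (x0, y0, q0, p0))"]
        time space) simp
qed

end
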